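(* Let $S$ be a restriction semigroup with local units, $\mathscr C(S)$ its universal category, and $K$ a commutative unital ring. The map $$F\colon S\to K\mathscr C(S),\qquad s\mapsto\chi_{(s,D_{s^*})},$$ where $(s,D_{s^*})=\{[s,\varphi]:\varphi\in D_{s^*}\}$, extends to an isomorphism of $K$-algebras $F\colon KS\to K\mathscr C(S)$ from the semigroup algebra of $S$ onto the convolution algebra of $\mathscr C(S)$.
   Context: **Restriction semigroups.** A restriction semigroup is an algebra $(S;\cdot,{}^* )$ where $(S;\cdot)$ is a semigroup and ${}^*$ is a unary operation with $xx^*=x$, $x^*y^*=y^*x^*=(x^*y^* )^*$, $(xy)^*=(x^*y)^*$, $x^*y=y(xy)^*$. $P(S)=\{s^*:s\in S\}$ is the semilattice of projections ($e\le f\Leftrightarrow e=ef$). The natural partial order is $s\le t\Leftrightarrow s=ts^*$. $S$ has local units if for every $s$ there are $e,f\in P(S)$ with $es=sf=s$. **Universal category.** $\widehat{P(S)}$ is the set of non-zero semilattice morphisms $P(S)\to\{0,1\}$, with the topology whose basis consists of the sets $D_e=\{\varphi:\varphi(e)=1\}$ and $D_e\setminus(D_{f_1}\cup\dots\cup D_{f_k})$, $f_i\le e$, $k\geq 1$. For $s\in S$, $\beta_s$ is the partial self-map of $\widehat{P(S)}$ with domain $D_{s^*}$ and $\beta_s(\varphi)(e)=\varphi((es)^* )$. For pairs $(s,\varphi)$ with $\varphi\in D_{s^*}$ put $(s,\varphi)\sim(t,\psi)$ iff $\varphi=\psi$ and there is $u\le s,t$ with $\varphi\in D_{u^*}$;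 the class of $(s,\varphi)$ is the germ $[s,\varphi]$. $\mathscr C(S)$ is the set of germs, a category with $\mathbf d([s,\varphi])=[s^*,\varphi]$, $\mathbf r([s,\varphi])=[e,\beta_s(\varphi)]$ for any $e\in P(S)$ with $\beta_s(\varphi)\in D_e$, and product $[s,\beta_t(\varphi)][t,\varphi]=[st,\varphi]$ (the product $xy$ is defined iff $\mathbf r(y)=\mathbf d(x)$). Its topology has basis the sets $(s,U)=\{[s,\varphi]:\varphi\in U\}$, $s\in S$, $U\subseteq D_{s^*}$ open. It is an ample topological category. **Convolution algebra.** A slice of a topological category $\mathcal C$ is an open $U\subseteq\mathcal C$ such that $\mathbf d|_U$ is a homeomorphism onto an open subset of the unit space $\mathcal C^{(0)}$. For an ample category $\mathcal C$ (étale, i.e. $\mathcal C^{(0)}$ locally compact Hausdorff and $\mathbf d$ a local homeomorphism, with compact slices forming a basis of the topology), $K\mathcal C$ is the $K$-module of functions $\mathcal C\to K$ spanned by the characteristic functions $\chi_U$ of compact slices $U$, with product $(f*g)(x)=\sum_{uv=x}f(u)g(v)$. **Semigroup algebra.** $KS$ is the free $K$-module with basis $S$, with multiplication extending that of $S$ bilinearly. *)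

theory Defs
  imports "HOL-Analysis.Abstract_Topology" "HOL-Library.Poly_Mapping"
begin

class restriction_semigroup = semigroup_mult +
  fixes star :: "'a \<Rightarrow> 'a"  ("(_\<^sup>\<star>)" [1000] 999)
  assumes mult_star: "x * x\<^sup>\<star> = x"
    and star_commute: "x\<^sup>\<star> * y\<^sup>\<star> = y\<^sup>\<star> * x\<^sup>\<star>"
    and star_mult_closed: "y\<^sup>\<star> * x\<^sup>\<star> = (x\<^sup>\<star> * y\<^sup>\<star>)\<^sup>\<star>"
    and star_mult: "(x * y)\<^sup>\<star> = (x\<^sup>\<star> * y)\<^sup>\<star>"
    and star_mult_swap: "x\<^sup>\<star> * y = y * (x * y)\<^sup>\<star>"

definition projections :: "'a::restriction_semigroup set"
  where "projections = range star"

definition nat_le :: "'a::restriction_semigroup \<Rightarrow> 'a \<Rightarrow> bool"  (infix "\<preceq>" 50)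
  where "s \<preceq> t \<longleftrightarrow> s = t * s\<^sup>\<star>"

text \<open>The semilattice \<open>{0,1}\<close> is the subset \<open>{0,1}\<close> of \<^typ>\<open>nat\<close> under multiplication. Characters are
  extensional functions on the set of projections.\<close>

definition characters :: "('a::restriction_semigroup \<Rightarrow> nat) set"
  where "characters =
    {\<phi> \<in> projections \<rightarrow>\<^sub>E {0, 1}.
      (\<forall>e\<in>projections. \<forall>f\<in>projections. \<phi> (e * f) = \<phi> e * \<phi> f) \<and> (\<exists>e\<in>projections. \<phi> e \<noteq> 0)}"

definition char_dom :: "'a::restriction_semigroup \<Rightarrow> ('a \<Rightarrow> nat) set"  ("\<D>")
  where "\<D> e = {\<phi> \<in> characters. \<phi> e = 1}"

definition char_topology :: "('a::restriction_semigroup \<Rightarrow> nat) topology"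
  where "char_topology = topology_generated_by
    ({\<D> e |e. e \<in> projections} \<union>
     {\<D> e - (\<Union>f\<in>A. \<D> f) |e A.
        e \<in> projections \<and> finite A \<and> A \<noteq> {} \<and> A \<subseteq> projections \<and> (\<forall>f\<in>A. f = f * e)})"

definition beta :: "'a::restriction_semigroup \<Rightarrow> ('a \<Rightarrow> nat) \<Rightarrow> ('a \<Rightarrow> nat)"  ("\<beta>")
  where "\<beta> s \<phi> = (\<lambda>e\<in>projections. \<phi> ((e * s)\<^sup>\<star>))"

text \<open>A small category in the arrows-only style, with the arrows being the points of the topology. The value
  \<open>compose_map C x y\<close> is meaningful only if \<open>ran_map C y = dom_map C x\<close>.\<close>

record 'c top_category =
  arrow_topology :: "'c topology"
  dom_map :: "'c \<Rightarrow> 'c"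
  ran_map :: "'c \<Rightarrow> 'c"
  compose_map :: "'c \<Rightarrow> 'c \<Rightarrow> 'c"

abbreviation arrows :: "'c top_category \<Rightarrow> 'c set"
  where "arrows C \<equiv> topspace (arrow_topology C)"

definition unit_space :: "'c top_category \<Rightarrow> 'c topology"
  where "unit_space C = subtopology (arrow_topology C) (dom_map C ` arrows C)"

definition slice :: "'c top_category \<Rightarrow> 'c set \<Rightarrow> bool"
  where "slice C U \<longleftrightarrow>
    openin (arrow_topology C) U \<and>
    openin (unit_space C) (dom_map C ` U) \<and>
    homeomorphic_map (subtopology (arrow_topology C) U)
      (subtopology (unit_space C) (dom_map C ` U)) (dom_map C)"

definition compact_slice :: "'c top_category \<Rightarrow> 'c set \<Rightarrow> bool"
  where "compact_slice C U \<longleftrightarrow> slice C U \<and> compactin (arrow_topology C) U"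

text \<open>The sort \<open>{comm_ring, comm_monoid_mult}\<close> below describes arbitrary commutative unital rings; unlike
  \<^class>\<open>comm_ring_1\<close> it does not exclude the zero ring, but constants such as \<^const>\<open>of_bool\<close> are not available.\<close>

definition char_fun :: "'c set \<Rightarrow> 'c \<Rightarrow> 'k::{comm_ring, comm_monoid_mult}"
  where "char_fun U = (\<lambda>x. if x \<in> U then 1 else 0)"

text \<open>A function on the set of arrows is encoded as a total function vanishing outside of it.\<close>

definition convolution_algebra :: "'c top_category \<Rightarrow> ('c \<Rightarrow> 'k::{comm_ring, comm_monoid_mult}) set"
  where "convolution_algebra C =
    {(\<lambda>x. \<Sum>U\<in>A. c U * char_fun U x) |A c. finite A \<and> (\<forall>U\<in>A. compact_slice C U)}"

text \<open>The conditions \<open>f u \<noteq> 0\<close> and \<open>g v \<noteq> 0\<close> only discard vanishing summands. They are needed since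
  \<^const>\<open>sum\<close> is zero on infinite index sets; for members of the convolution algebra of an ample
  category the index set below is finite.\<close>

definition convolution ::
    "'c top_category \<Rightarrow> ('c \<Rightarrow> 'k::{comm_ring, comm_monoid_mult}) \<Rightarrow> ('c \<Rightarrow> 'k) \<Rightarrow> 'c \<Rightarrow> 'k"
  where "convolution C f g x =
    (\<Sum>(u, v) \<in> {(u, v). u \<in> arrows C \<and> v \<in> arrows C \<and> ran_map C v = dom_map C u \<and>
        compose_map C u v = x \<and> f u \<noteq> 0 \<and> g v \<noteq> 0}. f u * g v)"

type_synonym 'a germ = "('a \<times> ('a \<Rightarrow> nat)) set"

definition germ_rel :: "(('a::restriction_semigroup \<times> ('a \<Rightarrow> nat)) \<times> ('a \<times> ('a \<Rightarrow> nat))) set"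
  where "germ_rel = {((s, \<phi>), (t, \<psi>)).
    \<phi> \<in> \<D> (s\<^sup>\<star>) \<and> \<psi> \<in> \<D> (t\<^sup>\<star>) \<and> \<phi> = \<psi> \<and> (\<exists>u. u \<preceq> s \<and> u \<preceq> t \<and> \<phi> \<in> \<D> (u\<^sup>\<star>))}"

definition germ :: "'a::restriction_semigroup \<Rightarrow> ('a \<Rightarrow> nat) \<Rightarrow> 'a germ"
  where "germ s \<phi> = germ_rel `` {(s, \<phi>)}"

definition germ_set :: "'a::restriction_semigroup \<Rightarrow> ('a \<Rightarrow> nat) set \<Rightarrow> 'a germ set"
  where "germ_set s U = {germ s \<phi> |\<phi>. \<phi> \<in> U}"

definition germ_topology :: "'a::restriction_semigroup germ topology"
  where "germ_topology =
    topology_generated_by {germ_set s U |s U. openin char_topology U \<and> U \<subseteq> \<D> (s\<^sup>\<star>)}"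

definition germ_dom :: "'a::restriction_semigroup germ \<Rightarrow> 'a germ"
  where "germ_dom x = (THE y. \<exists>s \<phi>. \<phi> \<in> \<D> (s\<^sup>\<star>) \<and> x = germ s \<phi> \<and> y = germ (s\<^sup>\<star>) \<phi>)"

definition germ_ran :: "'a::restriction_semigroup germ \<Rightarrow> 'a germ"
  where "germ_ran x = (THE y. \<exists>s \<phi> e. \<phi> \<in> \<D> (s\<^sup>\<star>) \<and> x = germ s \<phi> \<and>
    e \<in> projections \<and> \<beta> s \<phi> \<in> \<D> e \<and> y = germ e (\<beta> s \<phi>))"

definition germ_comp :: "'a::restriction_semigroup germ \<Rightarrow> 'a germ \<Rightarrow> 'a germ"
  where "germ_comp x y = (THE z. \<exists>s t \<phi>. \<phi> \<in> \<D> (t\<^sup>\<star>) \<and> \<beta> t \<phi> \<in> \<D> (s\<^sup>\<star>) \<and>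
    x = germ s (\<beta> t \<phi>) \<and> y = germ t \<phi> \<and> z = germ (s * t) \<phi>)"

definition universal_category :: "'a::restriction_semigroup germ top_category"
  where "universal_category =
    \<lparr>arrow_topology = germ_topology, dom_map = germ_dom, ran_map = germ_ran, compose_map = germ_comp\<rparr>"

text \<open>The free module with basis \<open>S\<close> is the type of finitely supported functions, in which
  \<open>Poly_Mapping.single s 1\<close> is the basis element \<open>s\<close>. The library's product on this type is
  not used, as it is for additively written monoids.\<close>

definition scalar_mult ::
    "'k::{comm_ring, comm_monoid_mult} \<Rightarrow> ('a \<Rightarrow>\<^sub>0 'k) \<Rightarrow> ('a \<Rightarrow>\<^sub>0 'k)"
  where "scalar_mult k a = Poly_Mapping.map ((*) k) a"

definition semigroup_algebra_mult ::
    "('a::semigroup_mult \<Rightarrow>\<^sub>0 'k::{comm_ring, comm_monoid_mult}) \<Rightarrow> ('a \<Rightarrow>\<^sub>0 'k) \<Rightarrow> ('a \<Rightarrow>\<^sub>0 'k)"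
  where "semigroup_algebra_mult a b =
    (\<Sum>s\<in>Poly_Mapping.keys a. \<Sum>t\<in>Poly_Mapping.keys b.
      Poly_Mapping.single (s * t) (Poly_Mapping.lookup a s * Poly_Mapping.lookup b t))"

end

theory Submission
  imports Defs "HOL-Analysis.Product_Topology"
begin

text \<open>Write \<open>\<Theta> s\<close> for the set of germs \<open>[s, \<phi>]\<close> with \<open>\<phi> \<in> \<D> (s\<^sup>\<star>)\<close>
  (below: \<open>full_germ_set s\<close>). The map \<open>\<phi> \<mapsto> [s, \<phi>]\<close> is a
  homeomorphism from the compact open set \<open>\<D> (s\<^sup>\<star>)\<close> onto \<open>\<Theta> s\<close>, so \<open>\<Theta> s\<close> is a compact slice.
  Multiplicativity holds since a germ \<open>[r, \<phi>]\<close> has at most one factorization in \<open>\<Theta> s \<times> \<Theta> t\<close>, namely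
  \<open>[s, \<beta> t \<phi>] [t, \<phi>]\<close>, which exists iff the germ lies in \<open>\<Theta> (s * t)\<close>.

  Injectivity: if \<open>\<epsilon>\<close> is the principal character of \<open>s\<^sup>\<star>\<close>, then \<open>[s, \<epsilon>] \<in> \<Theta> t\<close> iff \<open>s \<preceq> t\<close>. Hence
  evaluating the image of \<open>a\<close> at \<open>[s, \<epsilon>]\<close>, with \<open>s\<close> maximal in the support of \<open>a\<close>, returns the
  coefficient of \<open>s\<close>.

  Surjectivity: the part of \<open>\<Theta> s\<close> lying over \<open>\<D> e\<close> is \<open>\<Theta> (s * e)\<close>, so the range is closed under
  restriction to germs over \<open>\<D> e\<close>, and therefore over any difference of such sets. A compact slice is
  a finite union of sets \<open>{[s, \<phi>] | \<phi> \<in> W}\<close> with \<open>W\<close> basic; as germs in a slice are determined by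
  their characters, \<open>\<chi>(P \<union> Q) = \<chi>(P) + \<chi>(Q) - \<chi>(Q)|W\<close> for \<open>P\<close> such a set over \<open>W\<close>,
  where \<open>|W\<close> is restriction to germs over \<open>W\<close>, which allows induction on the number of sets.\<close>

section \<open>Restriction semigroups and germs\<close>

lemma star_star_mult [simp]: "(x::'a::restriction_semigroup)\<^sup>\<star> * x\<^sup>\<star> = x\<^sup>\<star>"
  by (metis mult_star star_mult star_mult_closed)

lemma star_star [simp]: "((x::'a::restriction_semigroup)\<^sup>\<star>)\<^sup>\<star> = x\<^sup>\<star>"
  by (metis star_star_mult star_mult_closed)

lemma star_in_projections [simp]: "x\<^sup>\<star> \<in> projections"
  by (simp add: projections_def)

lemma star_projection: "e \<in> projections \<Longrightarrow> e\<^sup>\<star> = e"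
  by (auto simp: projections_def)

lemma projection_mult_closed:
  assumes "e \<in> projections" "f \<in> projections"
  shows "e * f \<in> projections"
proof -
  have "e * f = (e * f)\<^sup>\<star>"
    by (metis assms star_commute star_mult_closed star_projection)
  then show ?thesis
    by (metis star_in_projections)
qed

lemma projection_commute:
  "e \<in> projections \<Longrightarrow> f \<in> projections \<Longrightarrow> e * f = f * e"
  by (metis star_commute star_projection)

lemma projection_idem: "e \<in> projections \<Longrightarrow> e * e = e"
  by (metis star_star_mult star_projection)

lemma star_mult_projection:
  assumes "e \<in> projections"
  shows "(s * e)\<^sup>\<star> = s\<^sup>\<star> * e"
  by (metis assms projection_mult_closed star_in_projections star_mult star_projection)

lemma projection_mult_swap:
  assumes "e \<in> projections"
  shows "e * s = s * (e * s)\<^sup>\<star>"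
  by (metis assms star_mult_swap star_projection)

lemma nat_le_star:
  assumes "u \<preceq> s"
  shows "s\<^sup>\<star> * u\<^sup>\<star> = u\<^sup>\<star>"
  by (metis assms nat_le_def star_in_projections star_mult_projection)

lemma nat_le_mult_projection:
  assumes "e \<in> projections"
  shows "s * e \<preceq> s"
  by (metis assms mult.assoc mult_star nat_le_def star_mult_projection)

text \<open>This form leaves the projection free, which makes transitivity and compatibility with
  products a matter of collecting projections on the right.\<close>

lemma nat_le_iff_projection: "u \<preceq> s \<longleftrightarrow> (\<exists>e\<in>projections. u = s * e)"
  by (metis nat_le_def nat_le_mult_projection star_in_projections)

lemma nat_le_refl: "s \<preceq> s"
  by (simp add: nat_le_def mult_star)

lemma nat_le_trans: "r \<preceq> s \<Longrightarrow> s \<preceq> t \<Longrightarrow> r \<preceq> t"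
  by (auto simp: nat_le_iff_projection mult.assoc intro: projection_mult_closed)

text \<open>The two inequalities give \<open>s\<^sup>\<star> = t\<^sup>\<star>\<close> because
  projections commute; then \<open>s = t * t\<^sup>\<star> = t\<close>.\<close>

lemma nat_le_antisym:
  assumes "s \<preceq> t" "t \<preceq> s"
  shows "s = t"
proof -
  have "s\<^sup>\<star> = t\<^sup>\<star>"
    using nat_le_star[OF assms(1)] nat_le_star[OF assms(2)] star_commute[of s t] by simp
  then show ?thesis
    using assms(1) by (simp add: nat_le_def mult_star)
qed

text \<open>The projection \<open>e\<close> standing between \<open>s\<close> and \<open>t\<close>
  is moved to the right across \<open>t\<close>, where it becomes
  \<open>(e * t)\<^sup>\<star>\<close> and merges with \<open>f\<close>.\<close>

lemma nat_le_mult: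
  assumes "u \<preceq> s" "v \<preceq> t"
  shows "u * v \<preceq> s * t"
proof -
  obtain e f where e: "e \<in> projections" "u = s * e" and f: "f \<in> projections" "v = t * f"
    using assms by (auto simp: nat_le_iff_projection)
  have "u * v = s * (e * t) * f"
    by (simp add: e f mult.assoc)
  also have "e * t = t * (e * t)\<^sup>\<star>"
    by (rule projection_mult_swap[OF e(1)])
  finally have "u * v = s * t * ((e * t)\<^sup>\<star> * f)"
    by (simp add: mult.assoc)
  then show ?thesis
    using f(1) nat_le_mult_projection projection_mult_closed star_in_projections by metis
qed

section \<open>Characters and the sets \<open>\<D> e\<close>\<close>

lemma charactersD:
  assumes "\<phi> \<in> characters"
  shows "\<phi> \<in> projections \<rightarrow>\<^sub>E {0, 1}"
    and "e \<in> projections \<Longrightarrow> f \<in> projections \<Longrightarrow> \<phi> (e * f) = \<phi> e * \<phi> f"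
    and "\<exists>e\<in>projections. \<phi> e = 1"
proof -
  show \<phi>: "\<phi> \<in> projections \<rightarrow>\<^sub>E {0, 1}"
    and "e \<in> projections \<Longrightarrow> f \<in> projections \<Longrightarrow> \<phi> (e * f) = \<phi> e * \<phi> f"
    using assms by (simp_all add: characters_def)
  obtain g where g: "g \<in> projections" "\<phi> g \<noteq> 0"
    using assms by (auto simp: characters_def)
  have "\<phi> g \<in> {0, 1}"
    using \<phi> g(1) by (rule PiE_mem)
  with g show "\<exists>e\<in>projections. \<phi> e = 1"
    by auto
qed

lemma char_dom_Int:
  assumes "e \<in> projections" "f \<in> projections"
  shows "\<D> (e * f) = \<D> e \<inter> \<D> f"
  using assms by (auto simp: char_dom_def charactersD(2))

lemma char_dom_star_mult_projection:
  "e \<in> projections \<Longrightarrow> \<D> ((s * e)\<^sup>\<star>) = \<D> (s\<^sup>\<star>) \<inter> \<D> e"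
  by (simp add: star_mult_projection char_dom_Int)

lemma char_dom_mono:
  assumes "u \<preceq> s"
  shows "\<D> (u\<^sup>\<star>) \<subseteq> \<D> (s\<^sup>\<star>)"
  by (metis assms char_dom_Int inf.cobounded1 nat_le_star star_in_projections)

section \<open>Germs and their equality\<close>

lemma germ_rel_refl: "\<phi> \<in> \<D> (s\<^sup>\<star>) \<Longrightarrow> ((s, \<phi>), (s, \<phi>)) \<in> germ_rel"
  using nat_le_refl by (auto simp: germ_rel_def)

lemma sym_germ_rel: "sym germ_rel"
  by (auto simp: germ_rel_def sym_def)

text \<open>Two restrictions \<open>u\<close> and \<open>v\<close> of the same \<open>s\<close>
  agree on their common domain: \<open>u * v\<^sup>\<star> = s * u\<^sup>\<star> * v\<^sup>\<star> =
  v * u\<^sup>\<star>\<close>. This element lies below both \<open>r\<close> and \<open>t\<close>,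
  and its domain still contains the character.\<close>

lemma trans_germ_rel: "trans germ_rel"
proof (rule transI, clarify)
  fix r s t :: 'a and \<phi> \<psi> \<chi>
  assume "((r, \<phi>), (s, \<psi>)) \<in> germ_rel" "((s, \<psi>), (t, \<chi>)) \<in> germ_rel"
  then obtain u v where eq: "\<phi> = \<psi>" "\<psi> = \<chi>" and r: "\<phi> \<in> \<D> (r\<^sup>\<star>)" and t: "\<phi> \<in> \<D> (t\<^sup>\<star>)"
    and u: "u \<preceq> r" "u \<preceq> s" "\<phi> \<in> \<D> (u\<^sup>\<star>)" and v: "v \<preceq> s" "v \<preceq> t" "\<phi> \<in> \<D> (v\<^sup>\<star>)"
    by (auto simp: germ_rel_def)
  have "u * v\<^sup>\<star> = s * u\<^sup>\<star> * v\<^sup>\<star>"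
    using u(2) by (metis nat_le_def)
  also have "\<dots> = v * u\<^sup>\<star>"
    by (metis mult.assoc nat_le_def star_commute v(1))
  finally have "u * v\<^sup>\<star> \<preceq> r" "u * v\<^sup>\<star> \<preceq> t"
    using u(1) v(2) nat_le_trans nat_le_mult_projection star_in_projections by metis+
  moreover have "\<phi> \<in> \<D> ((u * v\<^sup>\<star>)\<^sup>\<star>)"
    using u v by (simp add: char_dom_star_mult_projection)
  ultimately show "((r, \<phi>), (t, \<chi>)) \<in> germ_rel"
    using eq r t by (auto simp: germ_rel_def)
qed

text \<open>\<open>germ_rel\<close> is reflexive only on pairs whose character lies in the domain of
  the element; the hypotheses put both pairs there, so equality of classes is equivalence of
  representatives.\<close>

lemma germ_eq_iff:
  assumes "\<phi> \<in> \<D> (s\<^sup>\<star>)" "\<psi> \<in> \<D> (t\<^sup>\<star>)"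
  shows "germ s \<phi> = germ t \<psi> \<longleftrightarrow> \<phi> = \<psi> \<and> (\<exists>u. u \<preceq> s \<and> u \<preceq> t \<and> \<phi> \<in> \<D> (u\<^sup>\<star>))"
    (is "_ \<longleftrightarrow> ?R")
proof -
  have "germ s \<phi> = germ t \<psi> \<longleftrightarrow> ((s, \<phi>), (t, \<psi>)) \<in> germ_rel"
  proof
    assume "germ s \<phi> = germ t \<psi>"
    then show "((s, \<phi>), (t, \<psi>)) \<in> germ_rel"
      using germ_rel_refl[OF assms(2)] by (auto simp: germ_def)
  next
    assume *: "((s, \<phi>), (t, \<psi>)) \<in> germ_rel"
    then have "((t, \<psi>), (s, \<phi>)) \<in> germ_rel"
      using sym_germ_rel by (meson symD)
    with * show "germ s \<phi> = germ t \<psi>"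
      using trans_germ_rel by (auto simp: germ_def dest: transD)
  qed
  then show ?thesis
    using assms by (auto simp: germ_rel_def)
qed

lemma germ_nat_le:
  assumes "u \<preceq> s" "\<phi> \<in> \<D> (u\<^sup>\<star>)"
  shows "germ u \<phi> = germ s \<phi>"
  using assms char_dom_mono nat_le_refl by (subst germ_eq_iff) blast+

text \<open>Unit germs depend only on their character: \<open>e * f\<close> lies below both
  projections and its domain contains \<open>\<phi>\<close>.\<close>

lemma germ_projection_eq:
  assumes "e \<in> projections" "f \<in> projections" "\<phi> \<in> \<D> e" "\<phi> \<in> \<D> f"
  shows "germ e \<phi> = germ f \<phi>"
proof -
  have "\<phi> \<in> \<D> ((e * f)\<^sup>\<star>)"
    using assms by (simp add: char_dom_Int projection_mult_closed star_projection)
  moreover have "e * f \<preceq> e" "e * f \<preceq> f"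
    using assms nat_le_mult_projection projection_commute by metis+
  ultimately show ?thesis
    using germ_nat_le by metis
qed

text \<open>All pairs in a germ share one character, so the choice does not matter on germs.
  Elsewhere the value is arbitrary, but the functions later restricted by means of it vanish
  there.\<close>

definition germ_char :: "'a::restriction_semigroup germ \<Rightarrow> 'a \<Rightarrow> nat"
  where "germ_char x = snd (SOME p. p \<in> x)"

lemma germ_char_germ [simp]:
  assumes "\<phi> \<in> \<D> (s\<^sup>\<star>)"
  shows "germ_char (germ s \<phi>) = \<phi>"
proof -
  have "(s, \<phi>) \<in> germ s \<phi>"
    using germ_rel_refl[OF assms] by (simp add: germ_def)
  then have "(SOME p. p \<in> germ s \<phi>) \<in> germ s \<phi>"
    by (rule someI)
  then show ?thesis
    by (auto simp: germ_char_def germ_def germ_rel_def)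
qed

text \<open>The definite description in \<open>germ_dom\<close> is well defined: representatives of
  one germ have the same character, and that character determines the unit germ.\<close>

lemma germ_dom_germ:
  assumes "\<phi> \<in> \<D> (s\<^sup>\<star>)"
  shows "germ_dom (germ s \<phi>) = germ (s\<^sup>\<star>) \<phi>"
  unfolding germ_dom_def
proof (rule the_equality)
  show "\<exists>t \<psi>. \<psi> \<in> \<D> (t\<^sup>\<star>) \<and> germ s \<phi> = germ t \<psi> \<and> germ (s\<^sup>\<star>) \<phi> = germ (t\<^sup>\<star>) \<psi>"
    using assms by blast
next
  fix y
  assume "\<exists>t \<psi>. \<psi> \<in> \<D> (t\<^sup>\<star>) \<and> germ s \<phi> = germ t \<psi> \<and> y = germ (t\<^sup>\<star>) \<psi>"
  then obtain t \<psi> where t: "\<psi> \<in> \<D> (t\<^sup>\<star>)" "germ s \<phi> = germ t \<psi>" "y = germ (t\<^sup>\<star>) \<psi>"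
    by blast
  then have "\<phi> = \<psi>"
    using assms germ_eq_iff by blast
  with t assms show "y = germ (s\<^sup>\<star>) \<phi>"
    by (metis germ_projection_eq star_in_projections)
qed

section \<open>The action on characters, ranges and composites\<close>

lemma beta_apply: "e \<in> projections \<Longrightarrow> \<beta> s \<phi> e = \<phi> ((e * s)\<^sup>\<star>)"
  by (simp add: beta_def)

text \<open>Since \<open>(e * u)\<^sup>\<star> = (e * s)\<^sup>\<star> * u\<^sup>\<star>\<close> and
  \<open>\<phi> (u\<^sup>\<star>) = 1\<close>, the extra factor disappears under
  \<open>\<phi>\<close>. Hence \<open>\<beta> s \<phi>\<close> depends only on the germ.\<close>

lemma beta_nat_le:
  assumes "u \<preceq> s" "\<phi> \<in> \<D> (u\<^sup>\<star>)"
  shows "\<beta> u \<phi> = \<beta> s \<phi>"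
proof
  fix e
  show "\<beta> u \<phi> e = \<beta> s \<phi> e"
  proof (cases "e \<in> projections")
    case True
    have "e * u = (e * s) * u\<^sup>\<star>"
      using assms(1) by (metis mult.assoc nat_le_def)
    then have "(e * u)\<^sup>\<star> = (e * s)\<^sup>\<star> * u\<^sup>\<star>"
      by (simp add: star_mult_projection)
    moreover have "\<phi> \<in> characters" "\<phi> (u\<^sup>\<star>) = 1"
      using assms(2) by (auto simp: char_dom_def)
    ultimately show ?thesis
      using True by (simp add: beta_apply charactersD(2)[of \<phi>])
  qed (simp add: beta_def)
qed

lemma beta_germ_eq:
  assumes "\<phi> \<in> \<D> (s\<^sup>\<star>)" "\<psi> \<in> \<D> (t\<^sup>\<star>)" "germ s \<phi> = germ t \<psi>"
  shows "\<beta> s \<phi> = \<beta> t \<psi>"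
  using assms beta_nat_le germ_eq_iff by metis

text \<open>With \<open>e * s = s\<close> the value at \<open>e\<close> is
  \<open>\<phi> (s\<^sup>\<star>) = 1\<close>, so the map is non-zero. Multiplicativity comes from
  moving \<open>f\<close> across \<open>s\<close>, which gives
  \<open>e * f * s = e * s * (f * s)\<^sup>\<star>\<close>.\<close>

lemma beta_in_characters:
  assumes unit: "\<exists>e\<in>projections. e * s = s" and \<phi>: "\<phi> \<in> \<D> (s\<^sup>\<star>)"
  shows "\<beta> s \<phi> \<in> characters"
proof -
  have char: "\<phi> \<in> characters" and one: "\<phi> (s\<^sup>\<star>) = 1"
    using \<phi> by (auto simp: char_dom_def)
  have "\<beta> s \<phi> \<in> projections \<rightarrow>\<^sub>E {0, 1}"
    unfolding beta_def using PiE_mem[OF charactersD(1)[OF char] star_in_projections] by simp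
  moreover have "\<beta> s \<phi> (e * f) = \<beta> s \<phi> e * \<beta> s \<phi> f"
    if "e \<in> projections" "f \<in> projections" for e f
  proof -
    have "e * f * s = e * s * (f * s)\<^sup>\<star>"
      by (subst mult.assoc, subst projection_mult_swap[OF that(2)]) (simp add: mult.assoc)
    then have "(e * f * s)\<^sup>\<star> = (e * s)\<^sup>\<star> * (f * s)\<^sup>\<star>"
      by (simp add: star_mult_projection)
    then show ?thesis
      using that by (simp add: beta_apply projection_mult_closed charactersD(2)[OF char])
  qed
  moreover obtain e where "e \<in> projections" "\<beta> s \<phi> e = 1"
    using unit one by (metis beta_apply)
  ultimately show ?thesis
    unfolding characters_def by (intro CollectI conjI ballI bexI[of _ e]) simp_all
qed

text \<open>This decides when germs of \<open>s\<close> and \<open>t\<close> compose; it rests on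
  \<open>(s\<^sup>\<star> * t)\<^sup>\<star> = (s * t)\<^sup>\<star>\<close>.\<close>

lemma beta_mem_char_dom_star:
  assumes "\<exists>e\<in>projections. e * t = t" "\<phi> \<in> \<D> (t\<^sup>\<star>)"
  shows "\<beta> t \<phi> \<in> \<D> (s\<^sup>\<star>) \<longleftrightarrow> \<phi> \<in> \<D> ((s * t)\<^sup>\<star>)"
  using beta_in_characters[OF assms] assms(2)
  by (simp add: char_dom_def beta_apply star_mult[of s t])

lemma germ_ran_germ:
  assumes "\<phi> \<in> \<D> (s\<^sup>\<star>)" "e \<in> projections" "\<beta> s \<phi> \<in> \<D> e"
  shows "germ_ran (germ s \<phi>) = germ e (\<beta> s \<phi>)"
  unfolding germ_ran_def
proof (rule the_equality)
  show "\<exists>t \<psi> f. \<psi> \<in> \<D> (t\<^sup>\<star>) \<and> germ s \<phi> = germ t \<psi> \<and> f \<in> projections \<and> \<beta> t \<psi> \<in> \<D> f \<and>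
      germ e (\<beta> s \<phi>) = germ f (\<beta> t \<psi>)"
    using assms by blast
next
  fix y
  assume "\<exists>t \<psi> f. \<psi> \<in> \<D> (t\<^sup>\<star>) \<and> germ s \<phi> = germ t \<psi> \<and> f \<in> projections \<and> \<beta> t \<psi> \<in> \<D> f \<and>
      y = germ f (\<beta> t \<psi>)"
  then show "y = germ e (\<beta> s \<phi>)"
    using assms beta_germ_eq germ_projection_eq by metis
qed

text \<open>If other representatives share the restrictions \<open>u\<close> (of \<open>s\<close>
  and \<open>s'\<close>) and \<open>v\<close> (of \<open>t\<close> and \<open>t'\<close>), then
  \<open>u * v\<close> lies below both products. Its domain contains \<open>\<phi>\<close> because
  \<open>\<beta> v \<phi> = \<beta> t \<phi>\<close> lies in the domain of \<open>u\<close>.\<close>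

lemma germ_comp_germ:
  assumes unit: "\<forall>s::'a::restriction_semigroup. \<exists>e\<in>projections. e * s = s"
    and \<phi>: "\<phi> \<in> \<D> ((t::'a)\<^sup>\<star>)" and \<beta>: "\<beta> t \<phi> \<in> \<D> (s\<^sup>\<star>)"
  shows "germ_comp (germ s (\<beta> t \<phi>)) (germ t \<phi>) = germ (s * t) \<phi>"
  unfolding germ_comp_def
proof (rule the_equality)
  show "\<exists>s' t' \<psi>. \<psi> \<in> \<D> (t'\<^sup>\<star>) \<and> \<beta> t' \<psi> \<in> \<D> (s'\<^sup>\<star>) \<and>
    germ s (\<beta> t \<phi>) = germ s' (\<beta> t' \<psi>) \<and> germ t \<phi> = germ t' \<psi> \<and> germ (s * t) \<phi> = germ (s' * t') \<psi>"
    using \<phi> \<beta> by blast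
next
  fix z
  assume "\<exists>s' t' \<psi>. \<psi> \<in> \<D> (t'\<^sup>\<star>) \<and> \<beta> t' \<psi> \<in> \<D> (s'\<^sup>\<star>) \<and>
    germ s (\<beta> t \<phi>) = germ s' (\<beta> t' \<psi>) \<and> germ t \<phi> = germ t' \<psi> \<and> z = germ (s' * t') \<psi>"
  then obtain s' t' \<psi> where *: "\<psi> \<in> \<D> (t'\<^sup>\<star>)" "\<beta> t' \<psi> \<in> \<D> (s'\<^sup>\<star>)"
    "germ s (\<beta> t \<phi>) = germ s' (\<beta> t' \<psi>)" "germ t \<phi> = germ t' \<psi>" "z = germ (s' * t') \<psi>"
    by blast
  obtain v where v: "\<phi> = \<psi>" "v \<preceq> t" "v \<preceq> t'" "\<phi> \<in> \<D> (v\<^sup>\<star>)"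
    using \<phi> * germ_eq_iff by blast
  obtain u where u: "u \<preceq> s" "u \<preceq> s'" "\<beta> t \<phi> \<in> \<D> (u\<^sup>\<star>)"
    using \<beta> * germ_eq_iff by blast
  have "\<phi> \<in> \<D> ((u * v)\<^sup>\<star>)"
    using beta_mem_char_dom_star[of v \<phi> u] beta_nat_le[OF v(2,4)] unit u v by metis
  then show "z = germ (s * t) \<phi>"
    using germ_nat_le nat_le_mult u v * by metis
qed

section \<open>Topology of the universal category\<close>

text \<open>\<open>topology_generated_by\<close> treats its argument as a subbasis. The last
  assumption is the usual criterion for a base and carries the induction through binary
  intersections.\<close>

lemma topology_generated_by_imp_base:
  assumes "openin (topology_generated_by \<B>) U" "x \<in> U"
    and Int: "\<And>A B x. A \<in> \<B> \<Longrightarrow> B \<in> \<B> \<Longrightarrow> x \<in> A \<inter> B \<Longrightarrow> \<exists>C\<in>\<B>. x \<in> C \<and> C \<subseteq> A \<inter> B"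
  shows "\<exists>B\<in>\<B>. x \<in> B \<and> B \<subseteq> U"
proof -
  have "generate_topology_on \<B> U"
    using assms(1) by (rule openin_topology_generated_by)
  then have "\<forall>x\<in>U. \<exists>B\<in>\<B>. x \<in> B \<and> B \<subseteq> U"
  proof induction
    case (Int a b)
    show ?case
    proof
      fix x
      assume "x \<in> a \<inter> b"
      then obtain A B where "A \<in> \<B>" "x \<in> A" "A \<subseteq> a" "B \<in> \<B>" "x \<in> B" "B \<subseteq> b"
        using Int.IH by blast
      then show "\<exists>C\<in>\<B>. x \<in> C \<and> C \<subseteq> a \<inter> b"
        using assms(3)[of A B x] by blast
    qed
  next
    case (UN K)
    show ?case
    proof
      fix x
      assume "x \<in> \<Union>K"
      then obtain k where k: "k \<in> K" "x \<in> k"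
        by blast
      then obtain B where "B \<in> \<B>" "x \<in> B" "B \<subseteq> k"
        using UN.IH by meson
      with k show "\<exists>B\<in>\<B>. x \<in> B \<and> B \<subseteq> \<Union>K"
        by blast
    qed
  qed auto
  with assms(2) show ?thesis
    by blast
qed

section \<open>The topology of the character space\<close>

definition basic_char_sets :: "('a::restriction_semigroup \<Rightarrow> nat) set set"
  where "basic_char_sets =
    {\<D> e - (\<Union>f\<in>A. \<D> f) |e A. e \<in> projections \<and> finite A \<and> A \<subseteq> projections}"

text \<open>Subtracting \<open>\<D> f\<close> from \<open>\<D> e\<close> is the same as subtracting \<open>\<D> (f * e)\<close>, so the condition
  \<open>f \<le> e\<close> on the basis of the character space may be dropped.\<close>

lemma char_topology_eq: "char_topology = topology_generated_by basic_char_sets"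
proof -
  let ?\<B> = "{\<D> e |e. e \<in> projections} \<union> {\<D> e - (\<Union>f\<in>A. \<D> f) |e A.
        e \<in> projections \<and> finite A \<and> A \<noteq> {} \<and> A \<subseteq> projections \<and> (\<forall>f\<in>A. f = f * e)}
        :: ('a \<Rightarrow> nat) set set"
  have "?\<B> = basic_char_sets"
  proof (intro subset_antisym Un_least subsetI)
    fix B :: "('a \<Rightarrow> nat) set"
    assume "B \<in> {\<D> e |e. e \<in> projections}"
    then obtain e where "e \<in> projections" "B = \<D> e"
      by blast
    then show "B \<in> basic_char_sets"
      unfolding basic_char_sets_def by (intro CollectI exI[of _ e] exI[of _ "{}"]) simp
  next
    fix B :: "('a \<Rightarrow> nat) set"
    assume "B \<in> basic_char_sets"
    then obtain e A where e: "e \<in> projections" and A: "finite A" "A \<subseteq> projections"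
      and B: "B = \<D> e - (\<Union>f\<in>A. \<D> f)"
      unfolding basic_char_sets_def by blast
    show "B \<in> ?\<B>"
    proof (cases "A = {}")
      case True
      then show ?thesis
        using e B by auto
    next
      case False
      have "\<forall>f\<in>(\<lambda>f. f * e) ` A. f = f * e"
        using e by (auto simp: mult.assoc projection_idem)
      moreover have "(\<lambda>f. f * e) ` A \<subseteq> projections"
        using A e projection_mult_closed by blast
      moreover have "B = \<D> e - (\<Union>f\<in>(\<lambda>f. f * e) ` A. \<D> f)"
        using A e by (auto simp: B char_dom_Int subset_iff)
      ultimately show ?thesis
        using A False e by (intro UnI2 CollectI exI[of _ e] exI[of _ "(\<lambda>f. f * e) ` A"]) simp
    qed
  qed (auto simp: basic_char_sets_def)
  then show ?thesis
    by (simp only: char_topology_def)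
qed

lemma openin_basic_char_set:
  "e \<in> projections \<Longrightarrow> finite A \<Longrightarrow> A \<subseteq> projections \<Longrightarrow>
    openin char_topology (\<D> e - (\<Union>f\<in>A. \<D> f))"
  unfolding char_topology_eq basic_char_sets_def by (rule topology_generated_by_Basis) blast

lemma openin_char_dom: "e \<in> projections \<Longrightarrow> openin char_topology (\<D> e)"
  using openin_basic_char_set[of e "{}"] by simp

lemma char_dom_subset_topspace: "e \<in> projections \<Longrightarrow> \<D> e \<subseteq> topspace char_topology"
  using openin_char_dom by (rule openin_subset)

text \<open>The basic sets are closed under intersection: the projections are multiplied and the
  removed families united. An empty \<open>A\<close> stands for \<open>\<D> e\<close>
  itself.\<close>

lemma char_topology_base:
  assumes "openin char_topology U" "\<phi> \<in> U"
  obtains e A where "e \<in> projections" "finite A" "A \<subseteq> projections"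
    "\<phi> \<in> \<D> e - (\<Union>f\<in>A. \<D> f)" "\<D> e - (\<Union>f\<in>A. \<D> f) \<subseteq> U"
proof -
  have "\<exists>B\<in>basic_char_sets. \<phi> \<in> B \<and> B \<subseteq> U"
  proof (rule topology_generated_by_imp_base)
    show "openin (topology_generated_by basic_char_sets) U"
      using assms(1) by (simp add: char_topology_eq)
    fix B C \<psi>
    assume "B \<in> basic_char_sets" "C \<in> basic_char_sets" and \<psi>: "\<psi> \<in> B \<inter> C"
    then obtain e A f A' where B: "e \<in> projections" "finite A" "A \<subseteq> projections" "B = \<D> e - (\<Union>f\<in>A. \<D> f)"
      and C: "f \<in> projections" "finite A'" "A' \<subseteq> projections" "C = \<D> f - (\<Union>f\<in>A'. \<D> f)"
      unfolding basic_char_sets_def by blast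
    have "B \<inter> C = \<D> (e * f) - (\<Union>f\<in>A \<union> A'. \<D> f)"
      using B C by (auto simp: char_dom_Int)
    then have "B \<inter> C \<in> basic_char_sets"
      unfolding basic_char_sets_def using B C
      by (intro CollectI exI[of _ "e * f"] exI[of _ "A \<union> A'"]) (simp add: projection_mult_closed)
    with \<psi> show "\<exists>D\<in>basic_char_sets. \<psi> \<in> D \<and> D \<subseteq> B \<inter> C"
      by (intro bexI[of _ "B \<inter> C"] conjI subset_refl)
  qed (fact assms(2))
  then obtain B where "B \<in> basic_char_sets" "\<phi> \<in> B" "B \<subseteq> U"
    by (elim bexE conjE)
  moreover from this(1) obtain e A where "e \<in> projections" "finite A" "A \<subseteq> projections"
    "B = \<D> e - (\<Union>f\<in>A. \<D> f)"
    unfolding basic_char_sets_def by blast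
  ultimately show thesis
    using that by simp
qed

text \<open>Tychonoff: \<open>\<D> e\<close> is closed in the compact product of copies of the
  discrete space \<open>{0, 1}\<close>, and the identity from this subspace into the character space
  is continuous.\<close>

lemma compactin_char_dom:
  assumes e: "(e::'a::restriction_semigroup) \<in> projections"
  shows "compactin char_topology (\<D> e)"
proof -
  define X where "X = product_topology (\<lambda>_. discrete_topology {0, 1::nat}) (projections::'a set)"
  have top: "topspace X = projections \<rightarrow>\<^sub>E {0, 1}"
    by (simp add: X_def)
  \<comment> \<open>These cylinders are clopen because the factors are discrete; the closed
    conditions below are built from them.\<close>
  define C where "C f i = {\<phi> \<in> topspace X. \<phi> f = i}" for f i
  have coord: "openin X (C f i)" "closedin X (C f i)"
    if "f \<in> projections" "i \<in> {0, 1}" for f i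
  proof -
    have *: "continuous_map X (discrete_topology {0, 1::nat}) (\<lambda>\<phi>. \<phi> f)"
      unfolding X_def by (rule continuous_map_product_projection[OF that(1)])
    show "openin X (C f i)"
      using openin_continuous_map_preimage[OF *, of "{i}"] that(2) by (simp add: C_def)
    show "closedin X (C f i)"
      using closedin_continuous_map_preimage[OF *, of "{i}"] that(2) by (simp add: C_def)
  qed
  have mult: "closedin X {\<phi> \<in> topspace X. \<phi> (f * g) = \<phi> f * \<phi> g}"
    if "f \<in> projections" "g \<in> projections" for f g
  proof -
    \<comment> \<open>The equation involves only three coordinates, so it is a finite union of
      intersections of cylinders, one for each pair of values at \<open>f\<close> and
      \<open>g\<close>.\<close>
    have "{\<phi> \<in> topspace X. \<phi> (f * g) = \<phi> f * \<phi> g} =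
        (\<Union>(i, j)\<in>{0, 1} \<times> {0, 1}. C f i \<inter> C g j \<inter> C (f * g) (i * j))"
    proof (intro subset_antisym subsetI)
      fix \<phi>
      assume \<phi>: "\<phi> \<in> {\<phi> \<in> topspace X. \<phi> (f * g) = \<phi> f * \<phi> g}"
      then have "\<phi> \<in> projections \<rightarrow>\<^sub>E {0, 1}"
        unfolding top by blast
      from PiE_mem[OF this that(1)] PiE_mem[OF this that(2)]
      have "(\<phi> f, \<phi> g) \<in> {0, 1} \<times> {0, 1}"
        by (rule SigmaI)
      with \<phi> show "\<phi> \<in> (\<Union>(i, j)\<in>{0, 1} \<times> {0, 1}. C f i \<inter> C g j \<inter> C (f * g) (i * j))"
        by (intro UN_I[of "(\<phi> f, \<phi> g)"]) (simp_all add: C_def)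
    next
      fix \<phi>
      assume "\<phi> \<in> (\<Union>(i, j)\<in>{0, 1} \<times> {0, 1}. C f i \<inter> C g j \<inter> C (f * g) (i * j))"
      then show "\<phi> \<in> {\<phi> \<in> topspace X. \<phi> (f * g) = \<phi> f * \<phi> g}"
        by (elim UN_E) (simp add: C_def split: prod.splits)
    qed
    moreover have "closedin X (C f i \<inter> C g j \<inter> C (f * g) (i * j))" if "i \<in> {0, 1}" "j \<in> {0, 1}" for i j
    proof -
      have "i * j \<in> {0, 1}"
        using that by auto
      show ?thesis
        by (intro closedin_Int coord(2) projection_mult_closed) fact+
    qed
    then have *: "closedin X (case p of (i, j) \<Rightarrow> C f i \<inter> C g j \<inter> C (f * g) (i * j))"
      if "p \<in> {0, 1} \<times> {0, 1}" for p
      using that by (cases p) (simp only: prod.case mem_Sigma_iff)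
    have "closedin X (\<Union>(i, j)\<in>{0, 1} \<times> {0, 1}. C f i \<inter> C g j \<inter> C (f * g) (i * j))"
    proof (intro closedin_Union finite_imageI finite_SigmaI)
      fix T
      assume "T \<in> (\<lambda>(i, j). C f i \<inter> C g j \<inter> C (f * g) (i * j)) ` ({0, 1} \<times> {0, 1})"
      then show "closedin X T"
        by (rule imageE) (simp only: *)
    qed simp_all
    ultimately show ?thesis
      by simp
  qed
  \<comment> \<open>The value 1 at \<open>e\<close> already excludes the zero map, so non-vanishing,
    which is not a closed condition by itself, need not be imposed separately.\<close>
  have "\<D> e = C e 1 \<inter>
      (\<Inter>(f, g)\<in>projections \<times> projections. {\<phi> \<in> topspace X. \<phi> (f * g) = \<phi> f * \<phi> g})"
  proof (intro subset_antisym subsetI)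
    fix \<phi>
    assume "\<phi> \<in> \<D> e"
    then have \<phi>: "\<phi> \<in> characters" "\<phi> e = 1"
      by (simp_all add: char_dom_def)
    have "\<phi> \<in> topspace X"
      unfolding top using \<phi>(1) by (rule charactersD(1))
    with \<phi> show "\<phi> \<in> C e 1 \<inter>
      (\<Inter>(f, g)\<in>projections \<times> projections. {\<phi> \<in> topspace X. \<phi> (f * g) = \<phi> f * \<phi> g})"
      by (simp add: C_def charactersD(2)[OF \<phi>(1)])
  next
    fix \<phi>
    assume \<phi>: "\<phi> \<in> C e 1 \<inter>
      (\<Inter>(f, g)\<in>projections \<times> projections. {\<phi> \<in> topspace X. \<phi> (f * g) = \<phi> f * \<phi> g})"
    then have "\<phi> \<in> projections \<rightarrow>\<^sub>E {0, 1}" "\<phi> e = 1"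
        "\<forall>f\<in>projections. \<forall>g\<in>projections. \<phi> (f * g) = \<phi> f * \<phi> g"
      unfolding C_def top by (blast, blast, blast)
    with e show "\<phi> \<in> \<D> e"
      unfolding char_dom_def characters_def by (intro CollectI conjI bexI[of _ e]) simp_all
  qed
  moreover have "closedin X \<dots>"
    using e by (intro closedin_Int closedin_Inter coord(2)) (auto intro: mult)
  ultimately have "closedin X (\<D> e)"
    by simp
  then have "compactin X (\<D> e)"
    by (rule closedin_compact_space[rotated]) (simp add: X_def compact_space_product_topology compact_space_discrete_topology)
  then have "compactin (subtopology X (\<D> e)) (\<D> e)"
    by (simp add: compactin_subtopology)
  \<comment> \<open>It suffices to test basic sets, and every \<open>\<D> f\<close> leaves a clopen
    trace on \<open>\<D> e\<close>.\<close>
  moreover have "continuous_map (subtopology X (\<D> e)) char_topology id"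
  proof -
    let ?Y = "subtopology X (\<D> e)"
    have sub: "\<D> e \<subseteq> topspace X"
      using closedin_subset[OF \<open>closedin X (\<D> e)\<close>] .
    have Y: "topspace ?Y = \<D> e"
      using sub by (simp only: topspace_subtopology inf.absorb2)
    have eq: "\<D> f \<inter> \<D> e = C f 1 \<inter> \<D> e" for f
      using sub by (auto simp: char_dom_def C_def)
    have clopen: "openin ?Y (\<D> f \<inter> \<D> e)" "closedin ?Y (\<D> f \<inter> \<D> e)" if "f \<in> projections" for f
      unfolding eq using coord[OF that, of 1] by (auto simp: openin_subtopology closedin_subtopology)
    have basic: "openin ?Y ((\<D> f - (\<Union>g\<in>A. \<D> g)) \<inter> \<D> e)"
      if "f \<in> projections" "finite A" "A \<subseteq> projections" for f A
    proof -
      have "(\<D> f - (\<Union>g\<in>A. \<D> g)) \<inter> \<D> e = \<D> f \<inter> \<D> e - (\<Union>g\<in>A. \<D> g \<inter> \<D> e)"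
        by blast
      moreover have "openin ?Y \<dots>"
        using that by (intro openin_diff clopen(1) closedin_Union) (auto intro: clopen(2))
      ultimately show ?thesis
        by simp
    qed
    show ?thesis
      unfolding char_topology_eq
    proof (rule continuous_on_generated_topo, goal_cases)
      case (1 U)
      then have "openin ?Y (U \<inter> \<D> e)"
        unfolding basic_char_sets_def using basic by blast
      then show ?case
        unfolding Y by simp
    next
      case 2
      then show ?case
        unfolding Y using char_dom_subset_topspace[OF e] by (simp add: char_topology_eq)
    qed
  qed
  ultimately have "compactin char_topology (id ` \<D> e)"
    by (rule image_compactin)
  then show ?thesis
    by simp
qed

section \<open>The topology of the germ space and its compact slices\<close>

lemma germ_set_Int:
  assumes "x \<in> germ_set s U \<inter> germ_set t V" "U \<subseteq> \<D> (s\<^sup>\<star>)" "V \<subseteq> \<D> (t\<^sup>\<star>)"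
  obtains u where "u \<preceq> s" "u \<preceq> t" "x \<in> germ_set u (U \<inter> V \<inter> \<D> (u\<^sup>\<star>))"
    "germ_set u (U \<inter> V \<inter> \<D> (u\<^sup>\<star>)) \<subseteq> germ_set s U \<inter> germ_set t V"
proof -
  obtain \<phi> \<psi> where \<phi>: "\<phi> \<in> U" "x = germ s \<phi>" and \<psi>: "\<psi> \<in> V" "x = germ t \<psi>"
    using assms(1) by (auto simp: germ_set_def)
  then obtain u where u: "\<phi> = \<psi>" "u \<preceq> s" "u \<preceq> t" "\<phi> \<in> \<D> (u\<^sup>\<star>)"
    using assms(2,3) germ_eq_iff[of \<phi> s \<psi> t] by blast
  \<comment> \<open>Over \<open>\<D> (u\<^sup>\<star>)\<close> an element and its restriction
    \<open>u\<close> have the same germs; this is applied to both \<open>s\<close> and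
    \<open>t\<close>.\<close>
  have sub: "germ_set u (U \<inter> V \<inter> \<D> (u\<^sup>\<star>)) \<subseteq> germ_set r W" if "u \<preceq> r" "U \<inter> V \<subseteq> W" for r W
    using that germ_nat_le[OF that(1)] by (fastforce simp: germ_set_def)
  have "x = germ u \<phi>"
    using u germ_nat_le \<phi>(2) by metis
  then have "x \<in> germ_set u (U \<inter> V \<inter> \<D> (u\<^sup>\<star>))"
    using u \<phi>(1) \<psi>(1) by (auto simp: germ_set_def)
  with u(2,3) show thesis
    by (intro that[of u] Int_greatest sub) auto
qed

lemma openin_germ_set:
  "openin char_topology U \<Longrightarrow> U \<subseteq> \<D> (s\<^sup>\<star>) \<Longrightarrow> openin germ_topology (germ_set s U)"
  unfolding germ_topology_def by (rule topology_generated_by_Basis) blast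

text \<open>The generating sets form a base: around a common germ, a common restriction
  \<open>u\<close> supplies a generating set inside the intersection.\<close>

lemma germ_topology_base:
  assumes "openin germ_topology W" "x \<in> W"
  obtains s U where "openin char_topology U" "U \<subseteq> \<D> (s\<^sup>\<star>)" "x \<in> germ_set s U" "germ_set s U \<subseteq> W"
proof -
  let ?\<B> = "{germ_set s U |s U. openin char_topology U \<and> U \<subseteq> \<D> (s\<^sup>\<star>)}"
  have "\<exists>B\<in>?\<B>. x \<in> B \<and> B \<subseteq> W"
  proof (rule topology_generated_by_imp_base)
    show "openin (topology_generated_by ?\<B>) W"
      using assms(1) by (simp add: germ_topology_def)
    fix B C y
    assume "B \<in> ?\<B>" "C \<in> ?\<B>" "y \<in> B \<inter> C"
    then obtain s U t V where B: "openin char_topology U" "U \<subseteq> \<D> (s\<^sup>\<star>)" "B = germ_set s U"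
      and C: "openin char_topology V" "V \<subseteq> \<D> (t\<^sup>\<star>)" "C = germ_set t V"
      and y: "y \<in> germ_set s U \<inter> germ_set t V"
      by blast
    obtain u where "y \<in> germ_set u (U \<inter> V \<inter> \<D> (u\<^sup>\<star>))" "germ_set u (U \<inter> V \<inter> \<D> (u\<^sup>\<star>)) \<subseteq> B \<inter> C"
      using germ_set_Int[OF y B(2) C(2)] B(3) C(3) by blast
    moreover have "openin char_topology (U \<inter> V \<inter> \<D> (u\<^sup>\<star>))"
      using B(1) C(1) by (intro openin_Int openin_char_dom star_in_projections)
    ultimately show "\<exists>D\<in>?\<B>. y \<in> D \<and> D \<subseteq> B \<inter> C"
      by blast
  qed (fact assms(2))
  then show thesis
    using that by blast
qed

lemma topspace_germ_topology:
  "topspace (germ_topology :: 'a::restriction_semigroup germ topology) = {germ s \<phi> |s \<phi>. \<phi> \<in> \<D> (s\<^sup>\<star>)}"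
proof -
  have "topspace (germ_topology :: 'a germ topology) = \<Union>{germ_set s U |s U. openin char_topology U \<and> U \<subseteq> \<D> (s\<^sup>\<star>)}"
    by (simp add: germ_topology_def)
  also have "\<Union>{germ_set s U |s U. openin char_topology U \<and> U \<subseteq> \<D> (s\<^sup>\<star>)}
      = (\<Union>s::'a. germ_set s (\<D> (s\<^sup>\<star>)))"
  proof (intro subset_antisym subsetI)
    fix x :: "'a germ"
    assume "x \<in> (\<Union>s. germ_set s (\<D> (s\<^sup>\<star>)))"
    then obtain s where "x \<in> germ_set s (\<D> (s\<^sup>\<star>))"
      by blast
    then show "x \<in> \<Union>{germ_set s U |s U. openin char_topology U \<and> U \<subseteq> \<D> (s\<^sup>\<star>)}"
      using openin_char_dom[OF star_in_projections, of s] by blast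
  qed (auto simp: germ_set_def)
  also have "\<dots> = {germ s \<phi> |s \<phi>. \<phi> \<in> \<D> (s\<^sup>\<star>)}"
    by (auto simp: germ_set_def)
  finally show ?thesis .
qed

text \<open>The inverse is \<open>germ_char\<close>, and images of open sets are generating sets,
  hence open. Continuity at \<phi> holds because an element \<open>t\<close> with the same germ as
  \<open>s\<close> at \<phi> has the same germs on the whole domain of a common restriction.\<close>

lemma homeomorphic_map_germ:
  "homeomorphic_map (subtopology char_topology (\<D> (s\<^sup>\<star>)))
     (subtopology germ_topology (germ_set s (\<D> (s\<^sup>\<star>)))) (germ s)"
    (is "homeomorphic_map ?X ?Y _")
proof (rule bijective_open_imp_homeomorphic_map)
  have X: "topspace ?X = \<D> (s\<^sup>\<star>)"
    using char_dom_subset_topspace[OF star_in_projections] by auto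
  have openX: "openin ?X U \<longleftrightarrow> openin char_topology U \<and> U \<subseteq> \<D> (s\<^sup>\<star>)" for U
    by (rule openin_open_subtopology) (simp add: openin_char_dom)
  have openD: "openin germ_topology (germ_set s (\<D> (s\<^sup>\<star>)))"
    by (simp add: openin_germ_set openin_char_dom)
  have openY: "openin ?Y W \<longleftrightarrow> openin germ_topology W \<and> W \<subseteq> germ_set s (\<D> (s\<^sup>\<star>))" for W
    by (rule openin_open_subtopology) (rule openD)
  have Y: "topspace ?Y = germ_set s (\<D> (s\<^sup>\<star>))"
    using openin_subset[OF openD] by auto
  show "continuous_map ?X ?Y (germ s)"
    unfolding continuous_map_def X Y
  proof (intro conjI allI impI)
    show "germ s \<in> \<D> (s\<^sup>\<star>) \<rightarrow> germ_set s (\<D> (s\<^sup>\<star>))"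
      by (auto simp: germ_set_def)
    fix W
    assume "openin ?Y W"
    then have W: "openin germ_topology W"
      by (simp add: openY)
    show "openin ?X {\<phi> \<in> \<D> (s\<^sup>\<star>). germ s \<phi> \<in> W}"
    proof (subst openin_subopen, intro ballI)
      fix \<phi>
      assume "\<phi> \<in> {\<phi> \<in> \<D> (s\<^sup>\<star>). germ s \<phi> \<in> W}"
      then have \<phi>: "\<phi> \<in> \<D> (s\<^sup>\<star>)" "germ s \<phi> \<in> W"
        by simp_all
      obtain t V where V: "openin char_topology V" "V \<subseteq> \<D> (t\<^sup>\<star>)" "germ s \<phi> \<in> germ_set t V" "germ_set t V \<subseteq> W"
        using germ_topology_base[OF W \<phi>(2)] .
      then obtain \<psi> where \<psi>: "\<psi> \<in> V" "germ s \<phi> = germ t \<psi>"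
        by (auto simp: germ_set_def)
      with \<phi>(1) V(2) obtain u where u: "\<phi> = \<psi>" "u \<preceq> s" "u \<preceq> t" "\<phi> \<in> \<D> (u\<^sup>\<star>)"
        using germ_eq_iff[of \<phi> s \<psi> t] by blast
      have "germ s \<chi> \<in> W" if "\<chi> \<in> V \<inter> \<D> (u\<^sup>\<star>)" for \<chi>
      proof -
        have "germ s \<chi> = germ t \<chi>"
          using that u germ_nat_le by (metis IntD2)
        then show ?thesis
          using that V(4) by (auto simp: germ_set_def)
      qed
      moreover have "openin ?X (V \<inter> \<D> (u\<^sup>\<star>))"
        unfolding openX using V(1) char_dom_mono[OF u(2)] openin_char_dom[OF star_in_projections, of u]
        by (auto intro: openin_Int)
      ultimately show "\<exists>T. openin ?X T \<and> \<phi> \<in> T \<and> T \<subseteq> {\<phi> \<in> \<D> (s\<^sup>\<star>). germ s \<phi> \<in> W}"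
        using u \<psi>(1) char_dom_mono[OF u(2)] by (intro exI[of _ "V \<inter> \<D> (u\<^sup>\<star>)"]) auto
    qed
  qed
  show "open_map ?X ?Y (germ s)"
    unfolding open_map_def openX openY
  proof (intro allI impI conjI)
    fix U
    assume U: "openin char_topology U \<and> U \<subseteq> \<D> (s\<^sup>\<star>)"
    have "germ s ` U = germ_set s U"
      by (auto simp: germ_set_def)
    moreover have "germ_set s U \<subseteq> germ_set s (\<D> (s\<^sup>\<star>))"
      using U by (auto simp: germ_set_def)
    ultimately show "openin germ_topology (germ s ` U)" "germ s ` U \<subseteq> germ_set s (\<D> (s\<^sup>\<star>))"
      using U by (simp_all add: openin_germ_set)
  qed
  show "germ s ` topspace ?X = topspace ?Y"
    unfolding X Y by (auto simp: germ_set_def)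
  show "inj_on (germ s) (topspace ?X)"
    unfolding X by (rule inj_on_inverseI[where g = germ_char]) simp
qed

lemma germ_dom_image: "U \<subseteq> \<D> (s\<^sup>\<star>) \<Longrightarrow> germ_dom ` germ_set s U = germ_set (s\<^sup>\<star>) U"
  by (auto simp: germ_set_def germ_dom_germ subset_iff intro!: image_eqI)

abbreviation (input) full_germ_set :: "'a::restriction_semigroup \<Rightarrow> 'a germ set"
  where "full_germ_set s \<equiv> germ_set s (\<D> (s\<^sup>\<star>))"

text \<open>On this set \<open>germ_dom\<close> is the inverse of \<open>germ s\<close> followed by
  \<open>germ (s\<^sup>\<star>)\<close>, a composite of two homeomorphisms through
  \<open>\<D> (s\<^sup>\<star>)\<close>. Compactness is carried over from
  \<open>\<D> (s\<^sup>\<star>)\<close>.\<close>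

lemma compact_slice_full_germ_set: "compact_slice universal_category (full_germ_set s)"
proof -
  let ?X = "subtopology char_topology (\<D> (s\<^sup>\<star>))"
  have open_set: "openin germ_topology (full_germ_set s)" for s :: 'a
    by (simp add: openin_germ_set openin_char_dom)
  have dom: "germ_dom ` full_germ_set s = full_germ_set (s\<^sup>\<star>)"
    by (simp add: germ_dom_image)
  have sub: "full_germ_set (s\<^sup>\<star>) \<subseteq> germ_dom ` topspace germ_topology"
    using openin_subset[OF open_set, of s] dom by blast
  have hom: "homeomorphic_map ?X (subtopology germ_topology (full_germ_set s)) (germ s)"
    by (rule homeomorphic_map_germ)
  have hom_star: "homeomorphic_map ?X (subtopology germ_topology (full_germ_set (s\<^sup>\<star>))) (germ (s\<^sup>\<star>))"
    using homeomorphic_map_germ[of "s\<^sup>\<star>"] by simp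
  obtain g where g: "homeomorphic_maps ?X (subtopology germ_topology (full_germ_set s)) (germ s) g"
    using hom homeomorphic_map_maps by blast
  have top: "topspace (subtopology germ_topology (full_germ_set s)) = full_germ_set s"
    using openin_subset[OF open_set] by auto
  have "homeomorphic_map (subtopology germ_topology (full_germ_set s)) ?X g"
    using g by (simp add: homeomorphic_maps_map)
  then have comp: "homeomorphic_map (subtopology germ_topology (full_germ_set s))
      (subtopology germ_topology (full_germ_set (s\<^sup>\<star>))) (germ (s\<^sup>\<star>) \<circ> g)"
    using hom_star by (rule homeomorphic_map_compose)
  have comp_eq: "(germ (s\<^sup>\<star>) \<circ> g) x = germ_dom x" if "x \<in> full_germ_set s" for x
  proof -
    obtain \<phi> where \<phi>: "x = germ s \<phi>" "\<phi> \<in> \<D> (s\<^sup>\<star>)"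
      using \<open>x \<in> full_germ_set s\<close> unfolding germ_set_def by blast
    then have "g x = \<phi>"
      using g char_dom_subset_topspace[OF star_in_projections] by (auto simp: homeomorphic_maps_def)
    with \<phi> show ?thesis
      by (simp add: germ_dom_germ)
  qed
  have "homeomorphic_map (subtopology germ_topology (full_germ_set s))
      (subtopology germ_topology (full_germ_set (s\<^sup>\<star>))) germ_dom"
    using comp by (rule homeomorphic_map_eq) (simp only: top comp_eq)
  \<comment> \<open>The image consists of units, so passing through the unit space first does not
    change the subspace topology.\<close>
  moreover have "subtopology (subtopology germ_topology (germ_dom ` topspace germ_topology)) (full_germ_set (s\<^sup>\<star>))
      = subtopology germ_topology (full_germ_set (s\<^sup>\<star>))"
    using sub by (simp add: subtopology_subtopology inf.absorb2)
  moreover have "openin (subtopology germ_topology (germ_dom ` topspace germ_topology)) (full_germ_set (s\<^sup>\<star>))"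
    using openin_subtopology_Int[OF open_set[of "s\<^sup>\<star>"], of "germ_dom ` topspace germ_topology"] sub
    by (simp add: inf.absorb1)
  moreover have "compactin germ_topology (full_germ_set s)"
  proof -
    have "compactin ?X (\<D> (s\<^sup>\<star>))"
      by (simp add: compactin_subtopology compactin_char_dom)
    then have "compactin (subtopology germ_topology (full_germ_set s)) (germ s ` \<D> (s\<^sup>\<star>))"
      by (rule image_compactin) (use hom homeomorphic_imp_continuous_map in blast)
    moreover have "germ s ` \<D> (s\<^sup>\<star>) = full_germ_set s"
      by (auto simp: germ_set_def)
    ultimately show ?thesis
      by (simp add: compactin_subtopology)
  qed
  ultimately show ?thesis
    using open_set by (simp add: compact_slice_def slice_def unit_space_def universal_category_def dom)
qed

section \<open>The isomorphism\<close>

definition algebra_map ::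
    "('a::restriction_semigroup \<Rightarrow>\<^sub>0 'k::{comm_ring, comm_monoid_mult}) \<Rightarrow> 'a germ \<Rightarrow> 'k"
  where "algebra_map a x =
    (\<Sum>s\<in>Poly_Mapping.keys a. Poly_Mapping.lookup a s * char_fun (full_germ_set s) x)"

text \<open>The added indices have coefficient zero. This allows images of different elements to be
  compared as sums over one index set.\<close>

lemma algebra_map_superset:
  assumes "finite A" "Poly_Mapping.keys a \<subseteq> A"
  shows "algebra_map a x = (\<Sum>s\<in>A. Poly_Mapping.lookup a s * char_fun (full_germ_set s) x)"
  unfolding algebra_map_def using assms
  by (intro sum.mono_neutral_left) (auto simp: in_keys_iff)

lemma algebra_map_single:
  "algebra_map (Poly_Mapping.single s k) x = k * char_fun (full_germ_set s) x"
  by (subst algebra_map_superset[of "{s}"]) (simp_all split: if_splits)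

lemma algebra_map_zero [simp]: "algebra_map 0 x = 0"
  by (simp add: algebra_map_def)

lemma algebra_map_add: "algebra_map (a + b) x = algebra_map a x + algebra_map b x"
proof -
  let ?A = "Poly_Mapping.keys a \<union> Poly_Mapping.keys b"
  have *: "algebra_map c x = (\<Sum>s\<in>?A. Poly_Mapping.lookup c s * char_fun (full_germ_set s) x)"
    if "Poly_Mapping.keys c \<subseteq> ?A" for c
    using that by (intro algebra_map_superset) simp_all
  show ?thesis
    by (simp add: *[OF Poly_Mapping.keys_add] *[OF Un_upper1] *[OF Un_upper2]
        lookup_add distrib_right sum.distrib)
qed

lemma algebra_map_diff: "algebra_map (a - b) x = algebra_map a x - algebra_map b x"
  using algebra_map_add[of "a - b" b x] by simp

lemma algebra_map_sum: "algebra_map (\<Sum>i\<in>I. f i) x = (\<Sum>i\<in>I. algebra_map (f i) x)"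
  by (induction I rule: infinite_finite_induct) (simp_all add: algebra_map_add)

lemma lookup_scalar_mult: "Poly_Mapping.lookup (scalar_mult k a) s = k * Poly_Mapping.lookup a s"
  by (simp add: scalar_mult_def Poly_Mapping.map.rep_eq when_def)

lemma algebra_map_scalar_mult: "algebra_map (scalar_mult k a) x = k * algebra_map a x"
proof -
  \<comment> \<open>Scaling can annihilate coefficients, so the support may shrink.\<close>
  have "Poly_Mapping.keys (scalar_mult k a) \<subseteq> Poly_Mapping.keys a"
    by (auto simp: in_keys_iff lookup_scalar_mult)
  then have "algebra_map (scalar_mult k a) x =
      (\<Sum>s\<in>Poly_Mapping.keys a. k * Poly_Mapping.lookup a s * char_fun (full_germ_set s) x)"
    by (subst algebra_map_superset[of "Poly_Mapping.keys a"]) (simp_all add: lookup_scalar_mult)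
  then show ?thesis
    by (simp add: algebra_map_def sum_distrib_left mult.assoc)
qed

section \<open>Restriction of the sets \<open>full_germ_set s\<close> to germs over
  \<open>\<D> e\<close>\<close>

lemma germ_in_full_germ_set:
  "\<phi> \<in> \<D> (s\<^sup>\<star>) \<Longrightarrow> germ s \<phi> \<in> full_germ_set s"
  unfolding germ_set_def by blast

lemma full_germ_setE:
  assumes "x \<in> full_germ_set s"
  obtains "x = germ s (germ_char x)" "germ_char x \<in> \<D> (s\<^sup>\<star>)"
proof -
  obtain \<phi> where "x = germ s \<phi>" "\<phi> \<in> \<D> (s\<^sup>\<star>)"
    using assms unfolding germ_set_def by blast
  then show thesis
    by (intro that) simp_all
qed

text \<open>Since \<open>s * e \<preceq> s\<close>, both elements have the same germs wherever
  \<open>s * e\<close> is defined, and its domain is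
  \<open>\<D> (s\<^sup>\<star>) \<inter> \<D> e\<close>.\<close>

lemma full_germ_set_mult_projection:
  assumes "e \<in> projections"
  shows "x \<in> full_germ_set (s * e) \<longleftrightarrow> x \<in> full_germ_set s \<and> germ_char x \<in> \<D> e"
proof
  assume "x \<in> full_germ_set (s * e)"
  then have x: "x = germ (s * e) (germ_char x)" "germ_char x \<in> \<D> ((s * e)\<^sup>\<star>)"
    by (blast elim: full_germ_setE)+
  then have "germ_char x \<in> \<D> (s\<^sup>\<star>)" "germ_char x \<in> \<D> e"
    using char_dom_star_mult_projection[OF assms, of s] by auto
  moreover have "x = germ s (germ_char x)"
    using x germ_nat_le[OF nat_le_mult_projection[OF assms]] by metis
  ultimately show "x \<in> full_germ_set s \<and> germ_char x \<in> \<D> e"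
    using germ_in_full_germ_set by metis
next
  assume "x \<in> full_germ_set s \<and> germ_char x \<in> \<D> e"
  then have x: "x = germ s (germ_char x)" "germ_char x \<in> \<D> ((s * e)\<^sup>\<star>)"
    using char_dom_star_mult_projection[OF assms, of s] by (auto elim: full_germ_setE)
  then have "x = germ (s * e) (germ_char x)"
    using germ_nat_le[OF nat_le_mult_projection[OF assms]] by metis
  then show "x \<in> full_germ_set (s * e)"
    using germ_in_full_germ_set x(2) by metis
qed

section \<open>Factorizations of germs and multiplicativity\<close>

definition factorizations ::
    "'a::restriction_semigroup germ set \<Rightarrow> 'a germ set \<Rightarrow> 'a germ \<Rightarrow> ('a germ \<times> 'a germ) set"
  where "factorizations U V x =
    {(u, v). u \<in> U \<and> v \<in> V \<and> germ_ran v = germ_dom u \<and> germ_comp u v = x}"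

text \<open>For \<open>v = germ t \<phi>\<close>, composability forces the character of
  \<open>u\<close> to be \<open>\<beta> t \<phi>\<close>, and the product
  \<open>germ (s * t) \<phi>\<close> determines \<phi>. Conversely, a germ of \<open>s * t\<close>
  has a character at which both factors are defined.\<close>

lemma factorizations_full_germ_set:
  assumes unit: "\<forall>s::'a::restriction_semigroup. \<exists>e\<in>projections. e * s = s"
  shows "factorizations (full_germ_set s) (full_germ_set t) (x :: 'a germ) =
    (if x \<in> full_germ_set (s * t)
     then {(germ s (\<beta> t (germ_char x)), germ t (germ_char x))} else {})"
proof -
  have char: "\<beta> t \<phi> \<in> characters" if "\<phi> \<in> \<D> (t\<^sup>\<star>)" for \<phi>
    using unit that beta_in_characters by blast
  have mem: "\<beta> t \<phi> \<in> \<D> (s\<^sup>\<star>) \<longleftrightarrow> \<phi> \<in> \<D> ((s * t)\<^sup>\<star>)" if "\<phi> \<in> \<D> (t\<^sup>\<star>)" for \<phi>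
    using unit that by (intro beta_mem_char_dom_star) blast+
  have left: "x \<in> full_germ_set (s * t) \<and> u = germ s (\<beta> t (germ_char x)) \<and> v = germ t (germ_char x)"
    if "(u, v) \<in> factorizations (full_germ_set s) (full_germ_set t) x" for u v
  proof -
    obtain \<psi> where u: "u = germ s \<psi>" "\<psi> \<in> \<D> (s\<^sup>\<star>)"
      using \<open>(u, v) \<in> _\<close> unfolding factorizations_def by (blast elim: full_germ_setE)
    obtain \<phi> where v: "v = germ t \<phi>" "\<phi> \<in> \<D> (t\<^sup>\<star>)"
      using \<open>(u, v) \<in> _\<close> unfolding factorizations_def by (blast elim: full_germ_setE)
    have comp: "germ_ran v = germ_dom u" "germ_comp u v = x"
      using \<open>(u, v) \<in> _\<close> unfolding factorizations_def by blast+
    obtain e where e: "e \<in> projections" "\<beta> t \<phi> \<in> \<D> e"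
      using charactersD(3)[OF char[OF v(2)]] char[OF v(2)] by (auto simp: char_dom_def)
    have "germ e (\<beta> t \<phi>) = germ (s\<^sup>\<star>) \<psi>"
      using comp(1) u v e by (simp add: germ_ran_germ germ_dom_germ)
    then have \<psi>: "\<beta> t \<phi> = \<psi>"
      using germ_eq_iff[of "\<beta> t \<phi>" e \<psi> "s\<^sup>\<star>"] e u(2) by (simp add: star_projection)
    then have \<phi>: "\<phi> \<in> \<D> ((s * t)\<^sup>\<star>)"
      using mem[OF v(2)] u(2) by simp
    have x: "x = germ (s * t) \<phi>"
      using comp(2) germ_comp_germ[OF unit v(2)] u v \<psi> by metis
    with \<phi> have "germ_char x = \<phi>"
      by simp
    with x u v \<phi> \<psi> show ?thesis
      by (simp add: germ_in_full_germ_set)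
  qed
  have right: "(germ s (\<beta> t (germ_char x)), germ t (germ_char x))
      \<in> factorizations (full_germ_set s) (full_germ_set t) x"
    if "x \<in> full_germ_set (s * t)"
  proof -
    define \<phi> where "\<phi> = germ_char x"
    have x: "x = germ (s * t) \<phi>" and \<phi>: "\<phi> \<in> \<D> ((s * t)\<^sup>\<star>)"
      using that by (auto simp: \<phi>_def elim: full_germ_setE)
    have t: "\<phi> \<in> \<D> (t\<^sup>\<star>)"
    proof -
      \<comment> \<open>As
        \<open>(s * t)\<^sup>\<star> = (s\<^sup>\<star> * t)\<^sup>\<star>\<close>, this puts the
        domain of \<open>s * t\<close> inside that of \<open>t\<close>.\<close>
      have "s\<^sup>\<star> * t \<preceq> t"
        by (subst star_mult_swap) (simp add: nat_le_mult_projection)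
      then show ?thesis
        using \<phi> char_dom_mono star_mult[of s t] by auto
    qed
    then have s: "\<beta> t \<phi> \<in> \<D> (s\<^sup>\<star>)"
      using mem \<phi> by blast
    have "germ_ran (germ t \<phi>) = germ_dom (germ s (\<beta> t \<phi>))"
      using s t by (simp add: germ_ran_germ[of _ _ "s\<^sup>\<star>"] germ_dom_germ)
    moreover have "germ_comp (germ s (\<beta> t \<phi>)) (germ t \<phi>) = x"
      using germ_comp_germ[OF unit t s] x by simp
    ultimately show ?thesis
      unfolding factorizations_def \<phi>_def[symmetric] using s t by (simp add: germ_in_full_germ_set)
  qed
  show ?thesis
  proof (cases "x \<in> full_germ_set (s * t)")
    case True
    have unique: "p = (germ s (\<beta> t (germ_char x)), germ t (germ_char x))"
      if "p \<in> factorizations (full_germ_set s) (full_germ_set t) x" for p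
      using left[of "fst p" "snd p"] that by (simp add: prod_eq_iff)
    show ?thesis
      unfolding if_P[OF True]
    proof (rule subset_antisym)
      show "factorizations (full_germ_set s) (full_germ_set t) x
          \<subseteq> {(germ s (\<beta> t (germ_char x)), germ t (germ_char x))}"
        by (rule subsetI, subst singleton_iff, rule unique)
    qed (simp only: insert_subset empty_subsetI right[OF True] simp_thms)
  next
    case False
    then have "p \<notin> factorizations (full_germ_set s) (full_germ_set t) x" for p
      using left[of "fst p" "snd p"] by auto
    then show ?thesis
      unfolding if_not_P[OF False] by (simp add: set_eq_iff)
  qed
qed

lemma full_germ_set_subset_topspace: "full_germ_set s \<subseteq> topspace germ_topology"
  using openin_germ_set[OF openin_char_dom[OF star_in_projections]] by (intro openin_subset) blast

lemma algebra_map_support: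
  assumes "algebra_map a x \<noteq> 0"
  shows "x \<in> (\<Union>s\<in>Poly_Mapping.keys a. full_germ_set s)"
proof (rule ccontr)
  assume "x \<notin> (\<Union>s\<in>Poly_Mapping.keys a. full_germ_set s)"
  then have "algebra_map a x = 0"
    unfolding algebra_map_def by (intro sum.neutral) (simp add: char_fun_def)
  with assms show False ..
qed

text \<open>Expanding both factors and exchanging finite sums reduces the claim to basis elements,
  where the convolution counts factorizations of \<open>x\<close>, of which there is at most
  one.\<close>

lemma algebra_map_mult:
  fixes a b :: "'a::restriction_semigroup \<Rightarrow>\<^sub>0 'k::{comm_ring, comm_monoid_mult}"
  assumes unit: "\<forall>s::'a. \<exists>e\<in>projections. e * s = s"
  shows "algebra_map (semigroup_algebra_mult a b) (x :: 'a germ) =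
    convolution universal_category (algebra_map a) (algebra_map b) x"
proof -
  define A B where "A = Poly_Mapping.keys a" and "B = Poly_Mapping.keys b"
  have fin: "finite A" "finite B"
    by (simp_all add: A_def B_def)
  \<comment> \<open>One finite index set containing every pair that can contribute, for all basis
    elements at once; it is finite because each pair \<open>s\<close>, \<open>t\<close> yields at
    most one factorization.\<close>
  define \<T> where "\<T> = factorizations (\<Union>s\<in>A. full_germ_set s) (\<Union>t\<in>B. full_germ_set t) x"
  have "\<T> = (\<Union>s\<in>A. \<Union>t\<in>B. factorizations (full_germ_set s) (full_germ_set t) x)"
    by (auto simp: \<T>_def factorizations_def)
  then have fin\<T>: "finite \<T>"
    using fin by (simp add: factorizations_full_germ_set[OF unit])
  have pair: "(\<Sum>(u, v)\<in>\<T>. char_fun (full_germ_set s) u * char_fun (full_germ_set t) v) =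
      (char_fun (full_germ_set (s * t)) x :: 'k)" if "s \<in> A" "t \<in> B" for s t
  proof -
    let ?F = "factorizations (full_germ_set s) (full_germ_set t) x"
    have "(\<Sum>(u, v)\<in>\<T>. char_fun (full_germ_set s) u * char_fun (full_germ_set t) v) =
        (\<Sum>p\<in>\<T>. if p \<in> ?F then 1 else 0 :: 'k)"
      by (rule sum.cong[OF refl]) (clarsimp simp: \<T>_def factorizations_def char_fun_def)
    also have "\<dots> = (\<Sum>p\<in>\<T> \<inter> ?F. 1)"
      using fin\<T> by (simp add: sum.inter_restrict)
    also have "\<T> \<inter> ?F = ?F"
      using that by (auto simp: \<T>_def factorizations_def)
    also have "(\<Sum>p\<in>?F. 1) = (char_fun (full_germ_set (s * t)) x :: 'k)"
      by (simp add: factorizations_full_germ_set[OF unit] char_fun_def)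
    finally show ?thesis .
  qed
  have "convolution universal_category (algebra_map a) (algebra_map b) x =
      (\<Sum>(u, v)\<in>\<T>. algebra_map a u * algebra_map b v)"
  proof -
    \<comment> \<open>The index set of the convolution is the part of \<open>\<T>\<close> on which
      both values are non-zero, so summing over all of \<open>\<T>\<close> only adds zero
      terms.\<close>
    have "{(u, v). u \<in> arrows universal_category \<and> v \<in> arrows universal_category \<and>
        ran_map universal_category v = dom_map universal_category u \<and>
        compose_map universal_category u v = x \<and> algebra_map a u \<noteq> 0 \<and> algebra_map b v \<noteq> 0} =
      {p \<in> \<T>. algebra_map a (fst p) \<noteq> 0 \<and> algebra_map b (snd p) \<noteq> 0}" (is "?I = ?J")
    proof (intro subset_antisym subsetI)
      fix p
      assume "p \<in> ?I"
      then show "p \<in> ?J"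
        using algebra_map_support[of a "fst p"] algebra_map_support[of b "snd p"]
        by (auto simp: \<T>_def factorizations_def A_def B_def universal_category_def)
    next
      fix p
      assume "p \<in> ?J"
      then show "p \<in> ?I"
        using full_germ_set_subset_topspace
        by (auto simp: \<T>_def factorizations_def universal_category_def)
    qed
    then show ?thesis
      unfolding convolution_def using fin\<T>
      by (simp only:) (rule sum.mono_neutral_left, auto)
  qed
  also have "\<dots> = (\<Sum>(u, v)\<in>\<T>. \<Sum>s\<in>A. \<Sum>t\<in>B. Poly_Mapping.lookup a s * Poly_Mapping.lookup b t *
      (char_fun (full_germ_set s) u * char_fun (full_germ_set t) v))"
    unfolding algebra_map_def A_def[symmetric] B_def[symmetric]
    by (intro sum.cong refl) (auto simp: sum_product mult_ac intro!: sum.cong)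
  also have "\<dots> = (\<Sum>s\<in>A. \<Sum>t\<in>B. Poly_Mapping.lookup a s * Poly_Mapping.lookup b t *
      (\<Sum>(u, v)\<in>\<T>. char_fun (full_germ_set s) u * char_fun (full_germ_set t) v))"
    unfolding sum_distrib_left split_def
    by (subst sum.swap, intro sum.cong refl, subst sum.swap, rule refl)
  also have "\<dots> = (\<Sum>s\<in>A. \<Sum>t\<in>B. Poly_Mapping.lookup a s * Poly_Mapping.lookup b t *
      char_fun (full_germ_set (s * t)) x)"
    by (intro sum.cong refl) (simp only: pair)
  also have "\<dots> = algebra_map (semigroup_algebra_mult a b) x"
    by (simp add: semigroup_algebra_mult_def algebra_map_sum algebra_map_single A_def B_def)
  finally show ?thesis
    by simp
qed

section \<open>Principal characters and injectivity\<close>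

definition principal_character :: "'a::restriction_semigroup \<Rightarrow> 'a \<Rightarrow> nat"
  where "principal_character e = (\<lambda>f\<in>projections. if e * f = e then 1 else 0)"

text \<open>\<open>principal_character e\<close> is the indicator of the filter of projections above
  \<open>e\<close>; it is multiplicative because \<open>e\<close> lies below \<open>g * h\<close>
  iff it lies below both \<open>g\<close> and \<open>h\<close>.\<close>

lemma principal_character_in_char_dom:
  assumes "e \<in> projections" "f \<in> projections"
  shows "principal_character e \<in> \<D> f \<longleftrightarrow> e * f = e"
proof -
  have "e * (g * h) = e \<longleftrightarrow> e * g = e \<and> e * h = e" if "g \<in> projections" "h \<in> projections" for g h
  proof
    assume *: "e * (g * h) = e"
    have "g * h * g = g * h"
      by (subst mult.assoc, subst projection_commute[OF that(2,1)])
        (simp add: projection_idem[OF that(1)] flip: mult.assoc)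
    then have "e * (g * h) * g = e * (g * h)"
      by (simp add: mult.assoc)
    then have "e * g = e"
      by (simp only: *)
    moreover from this * have "e * h = e"
      by (simp flip: mult.assoc)
    ultimately show "e * g = e \<and> e * h = e" ..
  qed (simp flip: mult.assoc)
  then have "principal_character e \<in> characters"
    unfolding characters_def principal_character_def using assms(1)
    by (intro CollectI conjI ballI bexI[of _ e])
      (simp_all add: projection_mult_closed projection_idem)
  then show ?thesis
    using assms by (simp add: char_dom_def principal_character_def)
qed

text \<open>A restriction \<open>u\<close> of \<open>s\<close> whose domain contains the principal
  character of \<open>s\<^sup>\<star>\<close> satisfies
  \<open>u\<^sup>\<star> = s\<^sup>\<star>\<close>, hence \<open>u = s\<close>. So a shared germ at
  this character forces \<open>s\<close> itself below \<open>t\<close>.\<close>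

lemma germ_principal_character_in_full_germ_set:
  "germ s (principal_character (s\<^sup>\<star>)) \<in> full_germ_set t \<longleftrightarrow> s \<preceq> t"
proof
  have \<epsilon>: "principal_character (s\<^sup>\<star>) \<in> \<D> (s\<^sup>\<star>)"
    by (simp add: principal_character_in_char_dom)
  {
    assume "germ s (principal_character (s\<^sup>\<star>)) \<in> full_germ_set t"
    then obtain \<psi> where "germ s (principal_character (s\<^sup>\<star>)) = germ t \<psi>" "\<psi> \<in> \<D> (t\<^sup>\<star>)"
      unfolding germ_set_def by blast
    then obtain u where u: "u \<preceq> s" "u \<preceq> t" "principal_character (s\<^sup>\<star>) \<in> \<D> (u\<^sup>\<star>)"
      using germ_eq_iff[OF \<epsilon>] by blast
    then have "s\<^sup>\<star> = u\<^sup>\<star>"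
      using nat_le_star[OF u(1)] by (simp add: principal_character_in_char_dom)
    then have "u = s"
      using u(1) by (simp add: nat_le_def flip: \<open>s\<^sup>\<star> = u\<^sup>\<star>\<close>) (simp add: mult_star)
    with u(2) show "s \<preceq> t"
      by simp
  next
    assume "s \<preceq> t"
    then show "germ s (principal_character (s\<^sup>\<star>)) \<in> full_germ_set t"
      using germ_nat_le[OF _ \<epsilon>] germ_in_full_germ_set char_dom_mono \<epsilon> by (metis subsetD)
  }
qed

text \<open>Needed to rewrite a linear combination indexed by elements of \<open>S\<close> as one
  indexed by compact slices. Principal germs give \<open>s \<preceq> t\<close> and
  \<open>t \<preceq> s\<close>.\<close>

lemma inj_full_germ_set: "inj full_germ_set"
proof (rule injI)
  fix s t :: 'a
  assume *: "full_germ_set s = full_germ_set t"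
  have "s \<preceq> t"
    unfolding germ_principal_character_in_full_germ_set[symmetric] *[symmetric]
    by (simp add: germ_principal_character_in_full_germ_set nat_le_refl)
  moreover have "t \<preceq> s"
    unfolding germ_principal_character_in_full_germ_set[symmetric] *
    by (simp add: germ_principal_character_in_full_germ_set nat_le_refl)
  ultimately show "s = t"
    by (rule nat_le_antisym)
qed

lemma algebra_map_eq_zero:
  assumes "algebra_map a = (\<lambda>x. 0)"
  shows "a = 0"
proof (rule ccontr)
  assume "a \<noteq> 0"
  then have ne: "Poly_Mapping.keys a \<noteq> {}"
    by simp
  have "\<exists>m\<in>Poly_Mapping.keys a. \<forall>s\<in>Poly_Mapping.keys a. s \<noteq> m \<longrightarrow> \<not> (m \<preceq> s \<and> m \<noteq> s)"
  proof (rule Finite_Set.bex_max_element)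
    show "asymp_on (Poly_Mapping.keys a) (\<lambda>s t. s \<preceq> t \<and> s \<noteq> t)"
      by (rule asymp_onI) (blast dest: nat_le_antisym)
    show "transp_on (Poly_Mapping.keys a) (\<lambda>s t. s \<preceq> t \<and> s \<noteq> t)"
      by (rule transp_onI) (blast dest: nat_le_antisym intro: nat_le_trans)
  qed (use ne in simp_all)
  then obtain m where m: "m \<in> Poly_Mapping.keys a"
    and max: "\<And>s. s \<in> Poly_Mapping.keys a \<Longrightarrow> m \<preceq> s \<longleftrightarrow> s = m"
    using nat_le_refl by blast
  \<comment> \<open>The term of \<open>s\<close> survives at this germ only if
    \<open>m \<preceq> s\<close>, which by maximality leaves \<open>s = m\<close>.\<close>
  have "algebra_map a (germ m (principal_character (m\<^sup>\<star>))) =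
      (\<Sum>s\<in>Poly_Mapping.keys a. if s = m then Poly_Mapping.lookup a s else 0)"
    unfolding algebra_map_def
    by (intro sum.cong refl) (simp add: char_fun_def germ_principal_character_in_full_germ_set max)
  also have "\<dots> = Poly_Mapping.lookup a m"
    using m by simp
  finally show False
    using assms m by (simp add: in_keys_iff)
qed

lemma inj_algebra_map: "inj algebra_map"
proof (rule injI)
  fix a b :: "'a \<Rightarrow>\<^sub>0 'b"
  assume "algebra_map a = algebra_map b"
  then have "algebra_map (a - b) = (\<lambda>x. 0)"
    by (simp add: fun_eq_iff algebra_map_diff)
  then show "a = b"
    using algebra_map_eq_zero by fastforce
qed

section \<open>Closure properties of the range\<close>

lemma range_algebra_map_restrict:
  assumes "e \<in> projections" "f \<in> range algebra_map"
  shows "(\<lambda>x. if germ_char x \<in> \<D> e then f x else 0) \<in> range algebra_map"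
proof -
  obtain a where f: "f = algebra_map a"
    using assms(2) by blast
  \<comment> \<open>The preimage replaces each \<open>s\<close> by \<open>s * e\<close>; it is
    written as a sum because different \<open>s\<close> may give the same product.\<close>
  have "(\<lambda>x. if germ_char x \<in> \<D> e then f x else 0) =
      algebra_map (\<Sum>s\<in>Poly_Mapping.keys a. Poly_Mapping.single (s * e) (Poly_Mapping.lookup a s))"
    using full_germ_set_mult_projection[OF assms(1)]
    by (simp add: fun_eq_iff f algebra_map_sum algebra_map_single algebra_map_def[of a] char_fun_def)
  then show ?thesis
    by blast
qed

lemma range_algebra_map_diff:
  "f \<in> range algebra_map \<Longrightarrow> g \<in> range algebra_map \<Longrightarrow> (\<lambda>x. f x - g x) \<in> range algebra_map"
  by (auto simp: image_iff fun_eq_iff simp flip: algebra_map_diff)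

lemma range_algebra_map_add:
  "f \<in> range algebra_map \<Longrightarrow> g \<in> range algebra_map \<Longrightarrow> (\<lambda>x. f x + g x) \<in> range algebra_map"
  by (auto simp: image_iff fun_eq_iff simp flip: algebra_map_add)

text \<open>The sets \<open>\<D> h\<close> are removed one at a time, by subtracting from the
  function obtained so far its restriction to \<open>\<D> h\<close>.\<close>

lemma range_algebra_map_restrict_diff:
  assumes "finite A" "A \<subseteq> projections" "e \<in> projections" "f \<in> range algebra_map"
  shows "(\<lambda>x. if germ_char x \<in> \<D> e - (\<Union>h\<in>A. \<D> h) then f x else 0) \<in> range algebra_map"
  using assms(1,2)
proof (induction A)
  case empty
  then show ?case
    using range_algebra_map_restrict[OF assms(3,4)] by simp
next
  case (insert h A)
  let ?g = "\<lambda>x. if germ_char x \<in> \<D> e - (\<Union>h\<in>A. \<D> h) then f x else 0"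
  have g: "?g \<in> range algebra_map"
    using insert by simp
  have "(\<lambda>x. ?g x - (if germ_char x \<in> \<D> h then ?g x else 0)) \<in> range algebra_map"
    using insert.prems by (intro range_algebra_map_diff g range_algebra_map_restrict) simp
  also have "(\<lambda>x. ?g x - (if germ_char x \<in> \<D> h then ?g x else 0)) =
      (\<lambda>x. if germ_char x \<in> \<D> e - (\<Union>h\<in>insert h A. \<D> h) then f x else 0)"
    by (auto simp: fun_eq_iff)
  finally show ?case .
qed

lemma germ_set_iff:
  assumes "W \<subseteq> \<D> (s\<^sup>\<star>)"
  shows "x \<in> germ_set s W \<longleftrightarrow> x \<in> full_germ_set s \<and> germ_char x \<in> W"
proof
  assume "x \<in> germ_set s W"
  then obtain \<phi> where "x = germ s \<phi>" "\<phi> \<in> W"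
    unfolding germ_set_def by blast
  with assms show "x \<in> full_germ_set s \<and> germ_char x \<in> W"
    by (auto intro: germ_in_full_germ_set)
next
  assume *: "x \<in> full_germ_set s \<and> germ_char x \<in> W"
  then obtain \<phi> where "x = germ s \<phi>" "\<phi> \<in> \<D> (s\<^sup>\<star>)"
    unfolding germ_set_def by blast
  moreover from this * have "\<phi> \<in> W"
    by simp
  ultimately show "x \<in> germ_set s W"
    unfolding germ_set_def by blast
qed

lemma char_fun_full_germ_set_in_range: "char_fun (full_germ_set s) \<in> range algebra_map"
proof -
  have "char_fun (full_germ_set s) = algebra_map (Poly_Mapping.single s 1)"
    by (simp add: fun_eq_iff algebra_map_single)
  then show ?thesis
    by blast
qed

definition basic_germ_sets :: "'a::restriction_semigroup germ set set"
  where "basic_germ_sets = {germ_set s (\<D> e - (\<Union>f\<in>A. \<D> f)) |s e A.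
    e \<in> projections \<and> finite A \<and> A \<subseteq> projections \<and> \<D> e - (\<Union>f\<in>A. \<D> f) \<subseteq> \<D> (s\<^sup>\<star>)}"

text \<open>The sets may overlap. Injectivity of \<open>germ_char\<close> turns the overlap of one
  set with the union of the others into a condition on characters alone, and the range is closed
  under restriction by such conditions.\<close>

lemma char_fun_Union_basic_in_range:
  fixes \<F> :: "'a::restriction_semigroup germ set set"
  assumes "finite \<F>" "\<F> \<subseteq> basic_germ_sets" "inj_on germ_char (\<Union>\<F>)"
  shows "char_fun (\<Union>\<F>) \<in> range
    (algebra_map :: ('a \<Rightarrow>\<^sub>0 'k::{comm_ring, comm_monoid_mult}) \<Rightarrow> _)" (is "_ \<in> ?R")
  using assms
proof (induction \<F>)
  case empty
  have "char_fun (\<Union>{}) = algebra_map (0 :: 'a \<Rightarrow>\<^sub>0 'k)"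
    by (simp add: fun_eq_iff char_fun_def)
  then show ?case
    by (simp only: rangeI)
next
  case (insert P \<F>)
  define Q where "Q = \<Union>\<F>"
  have "P \<in> basic_germ_sets"
    using insert.prems(1) by simp
  then obtain s e A where A: "e \<in> projections" "finite A" "A \<subseteq> projections"
    and W: "\<D> e - (\<Union>f\<in>A. \<D> f) \<subseteq> \<D> (s\<^sup>\<star>)" and P: "P = germ_set s (\<D> e - (\<Union>f\<in>A. \<D> f))"
    unfolding basic_germ_sets_def by blast
  define W where "W = \<D> e - (\<Union>f\<in>A. \<D> f)"
  have PW: "x \<in> P \<longleftrightarrow> x \<in> full_germ_set s \<and> germ_char x \<in> W" for x
    unfolding P W_def using W by (rule germ_set_iff)
  have restr: "(\<lambda>x. if germ_char x \<in> W then f x else 0) \<in> ?R" if "f \<in> ?R" for f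
    unfolding W_def using A that by (intro range_algebra_map_restrict_diff)
  have "inj_on germ_char Q"
    using insert.prems(2) by (rule inj_on_subset) (auto simp: Q_def)
  then have Q: "char_fun Q \<in> ?R"
    using insert.IH insert.prems(1) by (simp add: Q_def)
  have "char_fun P = (\<lambda>x. if germ_char x \<in> W then char_fun (full_germ_set s) x else 0 :: 'k)"
    by (auto simp: fun_eq_iff char_fun_def PW)
  then have P_range: "char_fun P \<in> ?R"
    using restr[OF char_fun_full_germ_set_in_range] by simp
  \<comment> \<open>The germ of \<open>s\<close> at the character of \<open>x\<close> lies in
    \<open>P\<close>, hence in the same union as \<open>x\<close>; having the same character, the
    two coincide.\<close>
  have W_P: "x \<in> P" if "x \<in> Q" "germ_char x \<in> W" for x
  proof -
    have "germ_char x \<in> \<D> (s\<^sup>\<star>)"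
      using that(2) W unfolding W_def by blast
    then have "germ s (germ_char x) \<in> P"
      using that(2) by (simp add: PW germ_in_full_germ_set)
    moreover have "germ_char (germ s (germ_char x)) = germ_char x"
      using \<open>germ_char x \<in> \<D> (s\<^sup>\<star>)\<close> by simp
    ultimately have "germ s (germ_char x) = x"
      using insert.prems(2) that(1) by (auto simp: Q_def dest: inj_onD)
    with \<open>germ s (germ_char x) \<in> P\<close> show ?thesis
      by simp
  qed
  have "\<Union>(insert P \<F>) = P \<union> Q"
    by (simp add: Q_def)
  \<comment> \<open>Restricting \<open>Q\<close> to germs over \<open>W\<close> gives exactly
    \<open>P \<inter> Q\<close>, so this is inclusion-exclusion.\<close>
  moreover have "char_fun (P \<union> Q) x =
      (char_fun P x + (char_fun Q x - (if germ_char x \<in> W then char_fun Q x else 0)) :: 'k)" for x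
  proof (cases "x \<in> P")
    case True
    then have "germ_char x \<in> W"
      by (simp add: PW)
    with True show ?thesis
      by (simp add: char_fun_def)
  next
    case False
    then have "x \<notin> Q \<or> germ_char x \<notin> W"
      using W_P by blast
    with False show ?thesis
      by (auto simp: char_fun_def)
  qed
  ultimately have "char_fun (\<Union>(insert P \<F>)) =
      (\<lambda>x. char_fun P x + (char_fun Q x - (if germ_char x \<in> W then char_fun Q x else 0)) :: 'k)"
    by (simp add: fun_eq_iff)
  also have "\<dots> \<in> ?R"
    by (intro range_algebra_map_add range_algebra_map_diff P_range Q restr)
  finally show ?case .
qed

section \<open>Compact slices as finite unions of basic sets\<close>

lemma germ_topology_basic:
  assumes "openin germ_topology U" "x \<in> U"
  shows "\<exists>P\<in>basic_germ_sets. openin germ_topology P \<and> x \<in> P \<and> P \<subseteq> U"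
proof -
  obtain s V where V: "openin char_topology V" "V \<subseteq> \<D> (s\<^sup>\<star>)" "x \<in> germ_set s V" "germ_set s V \<subseteq> U"
    using germ_topology_base[OF assms] .
  then obtain \<phi> where \<phi>: "\<phi> \<in> V" "x = germ s \<phi>"
    unfolding germ_set_def by blast
  obtain e A where A: "e \<in> projections" "finite A" "A \<subseteq> projections"
      and W: "\<phi> \<in> \<D> e - (\<Union>f\<in>A. \<D> f)" "\<D> e - (\<Union>f\<in>A. \<D> f) \<subseteq> V"
    using char_topology_base[OF V(1) \<phi>(1)] .
  define P where "P = germ_set s (\<D> e - (\<Union>f\<in>A. \<D> f))"
  have sub: "\<D> e - (\<Union>f\<in>A. \<D> f) \<subseteq> \<D> (s\<^sup>\<star>)"
    using W(2) V(2) by (rule subset_trans)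
  have "P \<in> basic_germ_sets"
    unfolding P_def basic_germ_sets_def using A sub by blast
  moreover have "openin germ_topology P"
    unfolding P_def using A sub by (intro openin_germ_set openin_basic_char_set)
  moreover have "x \<in> P"
    unfolding P_def germ_set_def using W(1) \<phi>(2) by blast
  moreover have "P \<subseteq> germ_set s V"
    unfolding P_def germ_set_def using W(2) by blast
  ultimately show ?thesis
    using V(4) by blast
qed

text \<open>Compactness gives a finite cover of \<open>U\<close> by basic sets contained in
  \<open>U\<close>. Germs with equal characters have the same domain unit, so injectivity of
  \<open>germ_dom\<close> on a slice yields injectivity of \<open>germ_char\<close>.\<close>

lemma char_fun_compact_slice_in_range:
  assumes "compact_slice universal_category U"
  shows "char_fun U \<in> range algebra_map"
proof -
  have compact: "compactin germ_topology U" and "open": "openin germ_topology U"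
    and hom: "homeomorphic_map (subtopology germ_topology U)
      (subtopology (unit_space universal_category) (germ_dom ` U)) germ_dom"
    using assms by (simp_all add: compact_slice_def slice_def universal_category_def)
  have sub: "U \<subseteq> topspace germ_topology"
    using "open" by (rule openin_subset)
  have inj_dom: "inj_on germ_dom U"
    using homeomorphic_imp_injective_map[OF hom] sub by (simp add: inf.absorb2)
  have inj: "inj_on germ_char U"
  proof (rule inj_onI)
    fix x y
    assume xy: "x \<in> U" "y \<in> U" and eq: "germ_char x = germ_char y"
    obtain s \<phi> where x: "x = germ s \<phi>" "\<phi> \<in> \<D> (s\<^sup>\<star>)"
      using xy(1) sub topspace_germ_topology by blast
    obtain t \<psi> where y: "y = germ t \<psi>" "\<psi> \<in> \<D> (t\<^sup>\<star>)"
      using xy(2) sub topspace_germ_topology by blast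
    have "\<phi> = \<psi>"
      using eq x y by simp
    then have "germ_dom x = germ_dom y"
      using x y germ_projection_eq[of "s\<^sup>\<star>" "t\<^sup>\<star>" \<phi>] by (simp add: germ_dom_germ)
    then show "x = y"
      using inj_dom xy by (simp add: inj_on_eq_iff)
  qed
  let ?\<U> = "{P \<in> basic_germ_sets. openin germ_topology P \<and> P \<subseteq> U}"
  have "U \<subseteq> \<Union>?\<U>"
    using germ_topology_basic[OF "open"] by fast
  then have "\<exists>\<F>. finite \<F> \<and> \<F> \<subseteq> ?\<U> \<and> U \<subseteq> \<Union>\<F>"
    by (intro compactinD[OF compact]) simp_all
  then obtain \<F> where \<F>: "finite \<F>" "\<F> \<subseteq> ?\<U>" "U \<subseteq> \<Union>\<F>"
    by blast
  then have U: "U = \<Union>\<F>"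
    by blast
  have "char_fun (\<Union>\<F>) \<in> range algebra_map"
    using \<F> inj unfolding U by (intro char_fun_Union_basic_in_range) auto
  then show ?thesis
    using U by simp
qed

lemma range_algebra_map: "range algebra_map = convolution_algebra universal_category"
proof (intro subset_antisym subsetI)
  fix f :: "'a germ \<Rightarrow> 'b"
  assume "f \<in> range algebra_map"
  then obtain a where f: "f = algebra_map a"
    by blast
  \<comment> \<open>Coefficients in \<open>convolution_algebra\<close> are indexed by slices, so the
    element is recovered from its slice by the inverse of the injective
    \<open>full_germ_set\<close>.\<close>
  have "f = (\<lambda>x. \<Sum>U\<in>full_germ_set ` Poly_Mapping.keys a.
      Poly_Mapping.lookup a (inv full_germ_set U) * char_fun U x)"
    by (simp add: fun_eq_iff f algebra_map_def inv_f_f[OF inj_full_germ_set]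
        sum.reindex[OF inj_on_subset[OF inj_full_germ_set subset_UNIV]])
  moreover have "\<forall>U\<in>full_germ_set ` Poly_Mapping.keys a. compact_slice universal_category U"
    using compact_slice_full_germ_set by blast
  ultimately show "f \<in> convolution_algebra universal_category"
    unfolding convolution_algebra_def
    by (intro CollectI exI[of _ "full_germ_set ` Poly_Mapping.keys a"]
        exI[of _ "\<lambda>U. Poly_Mapping.lookup a (inv full_germ_set U)"]) simp
next
  fix f :: "'a germ \<Rightarrow> 'b"
  assume "f \<in> convolution_algebra universal_category"
  then obtain \<A> c where f: "f = (\<lambda>x. \<Sum>U\<in>\<A>. c U * char_fun U x)"
    and \<A>: "\<forall>U\<in>\<A>. compact_slice universal_category U"
    unfolding convolution_algebra_def by blast
  have "\<forall>U\<in>\<A>. \<exists>a. algebra_map a = (char_fun U :: 'a germ \<Rightarrow> 'b)"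
    using \<A> char_fun_compact_slice_in_range by (metis rangeE)
  then obtain p where p: "\<forall>U\<in>\<A>. algebra_map (p U) = (char_fun U :: 'a germ \<Rightarrow> 'b)"
    by (auto dest!: bchoice)
  have "f = algebra_map (\<Sum>U\<in>\<A>. scalar_mult (c U) (p U))"
    using p by (simp add: fun_eq_iff f algebra_map_sum algebra_map_scalar_mult)
  then show "f \<in> range algebra_map"
    by blast
qed

theorem theorem9p5:
  assumes local_units:
    "\<forall>s::'a::restriction_semigroup. \<exists>e\<in>projections. \<exists>f\<in>projections. e * s = s \<and> s * f = s"
  shows "\<exists>F :: ('a \<Rightarrow>\<^sub>0 'k::{comm_ring, comm_monoid_mult}) \<Rightarrow> ('a germ \<Rightarrow> 'k).
    (\<forall>s. F (Poly_Mapping.single s 1) = char_fun (germ_set s (\<D> (s\<^sup>\<star>)))) \<and>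
    (\<forall>a b. F (a + b) = (\<lambda>x. F a x + F b x)) \<and>
    (\<forall>k a. F (scalar_mult k a) = (\<lambda>x. k * F a x)) \<and>
    (\<forall>a b. F (semigroup_algebra_mult a b) = convolution universal_category (F a) (F b)) \<and>
    bij_betw F UNIV (convolution_algebra universal_category)"
proof (intro exI[of _ algebra_map] conjI allI)
  have unit: "\<forall>s::'a. \<exists>e\<in>projections. e * s = s"
    using local_units by blast
  show "algebra_map (semigroup_algebra_mult a b) =
      convolution universal_category (algebra_map a) (algebra_map b)" for a b :: "'a \<Rightarrow>\<^sub>0 'k"
    using algebra_map_mult[OF unit] by blast
  show "bij_betw (algebra_map :: ('a \<Rightarrow>\<^sub>0 'k) \<Rightarrow> _) UNIV (convolution_algebra universal_category)"
    unfolding bij_betw_def using inj_algebra_map range_algebra_map by blast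
qed (simp_all add: fun_eq_iff algebra_map_single algebra_map_add algebra_map_scalar_mult)

end
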